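(* Let $\mathcal{C}$ be a skeletally small, idempotent complete triangulated category with suspension $[1]$, let $n\ge2$, and let $\mathcal{X}\subseteq\mathcal{C}$ be an $n$-cluster tilting subcategory with $\mathcal{X}[n]=\mathcal{X}$. Then there is an isomorphism of abelian groups $K_0(\mathcal{C})\cong K_0^{\mathrm{ang}}(\mathcal{X})$ induced by the index isomorphism $\operatorname{index}_{\mathcal{X}}\colon K_0(\mathcal{C}^{\mathcal{X}}_R)\to K_0^{\mathsf{sp}}(\mathcal{X})$; that is, it sends $[C]\in K_0(\mathcal{C})$ to the class of $\operatorname{index}_{\mathcal{X}}([C]^{\mathcal{X}}_R)$ in $K_0^{\mathrm{ang}}(\mathcal{X})$. (Here $K_0^{\mathrm{ang}}(\mathcal{X})$ denotes the Grothendieck group of the $(n+2)$-angulated category $\mathcal{X}$.)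
   Context: A full subcategory $\mathcal{X}\subseteq\mathcal{C}$ is $n$-cluster tilting if it is functorially finite and $\mathcal{X}=\{C\mid\mathcal{C}(\mathcal{X},C[i])=0,\ 1\le i\le n-1\}=\{C\mid\mathcal{C}(C,\mathcal{X}[i])=0,\ 1\le i\le n-1\}$. For $A,C\in\mathcal{C}$ let $\mathbb{E}^{\mathcal{X}}_R(C,A)=\{h\colon C\to A[1]\mid hx=0\ \text{for all }x\colon X\to C,\ X\in\mathcal{X}\}$. $\mathcal{C}^{\mathcal{X}}_R$ is the extriangulated category on $\mathcal{C}$ whose conflations are the sequences $A\to B\to C$ in a triangle $A\to B\to C\xrightarrow{h}A[1]$ with $h\in\mathbb{E}^{\mathcal{X}}_R(C,A)$; $K_0(\mathcal{C}^{\mathcal{X}}_R)$ is generated by isomorphism classes of objects modulo $[A]-[B]+[C]$ for these conflations, with $[C]^{\mathcal{X}}_R$ the class of $C$. $K_0(\mathcal{C})$ is the Grothendieck group of the triangulated category $\mathcal{C}$. $K_0^{\mathsf{sp}}(\mathcal{X})$ is the split Grothendieck group of $\mathcal{X}$. $\operatorname{index}_{\mathcal{X}}$ is the isomorphism $[C]^{\mathcal{X}}_R\mapsto\sum_{i=0}^{n-1}(-1)^i[X_i]^{\mathsf{sp}}$, where $X_{n-1}\to\cdots\to X_0\to C$ is obtained by splicing conflations $C_{i+1}\to X_i\to C_i$ of $\mathcal{C}^{\mathcal{X}}_R$ with $X_i\in\mathcal{X}$, $0\le i\le n-2$, $C_0=C$, $C_{n-1}=X_{n-1}$ (such resolutions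 always exist); its inverse is $[X]^{\mathsf{sp}}\mapsto[X]^{\mathcal{X}}_R$. Since $\mathcal{X}[n]=\mathcal{X}$, by Geiss--Keller--Oppermann $(\mathcal{X},[n])$ is an $(n+2)$-angulated category, whose $(n+2)$-angles are the sequences $X_{n+1}\to X_n\to\cdots\to X_1\to X_0\xrightarrow{h}X_{n+1}[n]$ in $\mathcal{X}$ for which there are triangles $C_{i+1}\xrightarrow{f_i}X_i\xrightarrow{g_i}C_i\xrightarrow{h_i}C_{i+1}[1]$ in $\mathcal{C}$, $1\le i\le n$, with $C_1=X_0$, $C_{n+1}=X_{n+1}$, such that $X_{n+1}\to X_n$ is $f_n$, $X_{i+1}\to X_i$ is $f_ig_{i+1}$ for $1\le i\le n-1$, $X_1\to X_0$ is $g_1$, and $h=h_n[n-1]\circ\cdots\circ h_2[1]\circ h_1$. $K_0^{\mathrm{ang}}(\mathcal{X})$ (Bergh--Thaule) is the quotient of $K_0^{\mathsf{sp}}(\mathcal{X})$ by the subgroup generated by the elements $\sum_{i=0}^{n+1}(-1)^i[X_i]^{\mathsf{sp}}$ for all $(n+2)$-angles. *)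

theory Defs
  imports "HOL-Algebra.Free_Abelian_Groups" "HOL-Algebra.Generated_Groups"
begin

section \<open>Triangulated categories\<close>

text \<open>
  Objects and arrows are the elements of two sets, every arrow knows its source and target, and
  composition is written right to left. All data is relevant only on \<open>Ob\<close> and \<open>Ar\<close>.
  As \<open>Ob\<close> and \<open>Ar\<close> are HOL sets, every category in this sense is small.
  \<open>shO\<close> and \<open>shM\<close> are the suspension $[1]$ on objects and on arrows, and a triple
  \<open>(f, g, h)\<close> in \<open>dtri\<close> stands for a distinguished triangle
  $A \to B \to D \to A[1]$, whose objects are the sources and targets of the arrows.
\<close>

record ('o, 'm) tricat =
  Ob :: "'o set"
  Ar :: "'m set"
  src :: "'m \<Rightarrow> 'o"
  tgt :: "'m \<Rightarrow> 'o"
  ident :: "'o \<Rightarrow> 'm"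
  cmp :: "'m \<Rightarrow> 'm \<Rightarrow> 'm" (infixl "\<cdot>\<index>" 70)
  madd :: "'m \<Rightarrow> 'm \<Rightarrow> 'm"
  mzero :: "'o \<Rightarrow> 'o \<Rightarrow> 'm"
  shO :: "'o \<Rightarrow> 'o"
  shM :: "'m \<Rightarrow> 'm"
  dtri :: "('m \<times> 'm \<times> 'm) set"

definition Mor :: "('o, 'm, 'z) tricat_scheme \<Rightarrow> 'o \<Rightarrow> 'o \<Rightarrow> 'm set" where
  "Mor C A B = {f \<in> Ar C. src C f = A \<and> tgt C f = B}"

definition Mor_group :: "('o, 'm, 'z) tricat_scheme \<Rightarrow> 'o \<Rightarrow> 'o \<Rightarrow> 'm monoid" where
  "Mor_group C A B = \<lparr>carrier = Mor C A B, mult = madd C, one = mzero C A B\<rparr>"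

definition mneg :: "('o, 'm, 'z) tricat_scheme \<Rightarrow> 'm \<Rightarrow> 'm" where
  "mneg C f = inv\<^bsub>Mor_group C (src C f) (tgt C f)\<^esub> f"

definition is_isomorphism :: "('o, 'm, 'z) tricat_scheme \<Rightarrow> 'o \<Rightarrow> 'o \<Rightarrow> 'm \<Rightarrow> bool" where
  "is_isomorphism C A B f \<longleftrightarrow> f \<in> Mor C A B \<and>
     (\<exists>g \<in> Mor C B A. g \<cdot>\<^bsub>C\<^esub> f = ident C A \<and> f \<cdot>\<^bsub>C\<^esub> g = ident C B)"

definition isomorphic :: "('o, 'm, 'z) tricat_scheme \<Rightarrow> 'o \<Rightarrow> 'o \<Rightarrow> bool" where
  "isomorphic C A B \<longleftrightarrow> (\<exists>f. is_isomorphism C A B f)"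

definition is_zero_object :: "('o, 'm, 'z) tricat_scheme \<Rightarrow> 'o \<Rightarrow> bool" where
  "is_zero_object C Z \<longleftrightarrow> Z \<in> Ob C \<and> ident C Z = mzero C Z Z"

definition is_biproduct :: "('o, 'm, 'z) tricat_scheme \<Rightarrow> 'o \<Rightarrow> 'o \<Rightarrow> 'o \<Rightarrow> bool" where
  "is_biproduct C A B D \<longleftrightarrow> A \<in> Ob C \<and> B \<in> Ob C \<and> D \<in> Ob C \<and>
     (\<exists>i \<in> Mor C A D. \<exists>j \<in> Mor C B D. \<exists>p \<in> Mor C D A. \<exists>q \<in> Mor C D B.
        p \<cdot>\<^bsub>C\<^esub> i = ident C A \<and> q \<cdot>\<^bsub>C\<^esub> j = ident C B \<and>
        q \<cdot>\<^bsub>C\<^esub> i = mzero C A B \<and> p \<cdot>\<^bsub>C\<^esub> j = mzero C B A \<and>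
        madd C (i \<cdot>\<^bsub>C\<^esub> p) (j \<cdot>\<^bsub>C\<^esub> q) = ident C D)"

locale additive_category =
  fixes C :: "('o, 'm, 'z) tricat_scheme" (structure)
  assumes src_tgt: "f \<in> Ar C \<Longrightarrow> src C f \<in> Ob C \<and> tgt C f \<in> Ob C"
    and ident_closed: "A \<in> Ob C \<Longrightarrow> ident C A \<in> Mor C A A"
    and cmp_closed: "\<lbrakk>f \<in> Mor C A B; g \<in> Mor C B D\<rbrakk> \<Longrightarrow> g \<cdot> f \<in> Mor C A D"
    and cmp_assoc: "\<lbrakk>f \<in> Mor C A B; g \<in> Mor C B D; h \<in> Mor C D E\<rbrakk>
          \<Longrightarrow> (h \<cdot> g) \<cdot> f = h \<cdot> (g \<cdot> f)"
    and cmp_ident_right: "f \<in> Mor C A B \<Longrightarrow> f \<cdot> ident C A = f"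
    and cmp_ident_left: "f \<in> Mor C A B \<Longrightarrow> ident C B \<cdot> f = f"
    and Mor_comm_group: "\<lbrakk>A \<in> Ob C; B \<in> Ob C\<rbrakk> \<Longrightarrow> comm_group (Mor_group C A B)"
    and cmp_add_right: "\<lbrakk>f \<in> Mor C A B; f' \<in> Mor C A B; g \<in> Mor C B D\<rbrakk>
          \<Longrightarrow> g \<cdot> madd C f f' = madd C (g \<cdot> f) (g \<cdot> f')"
    and cmp_add_left: "\<lbrakk>f \<in> Mor C A B; g \<in> Mor C B D; g' \<in> Mor C B D\<rbrakk>
          \<Longrightarrow> madd C g g' \<cdot> f = madd C (g \<cdot> f) (g' \<cdot> f)"
    and zero_object_exists: "\<exists>Z. is_zero_object C Z"
    and biproduct_exists: "\<lbrakk>A \<in> Ob C; B \<in> Ob C\<rbrakk> \<Longrightarrow> \<exists>D. is_biproduct C A B D"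

text \<open>
  The suspension is only required to be an additive autoequivalence; the convention that it is an
  automorphism is a special case.
\<close>

locale triangulated_category = additive_category +
  assumes shO_closed: "A \<in> Ob C \<Longrightarrow> shO C A \<in> Ob C"
    and shM_fully_faithful: "\<lbrakk>A \<in> Ob C; B \<in> Ob C\<rbrakk>
          \<Longrightarrow> bij_betw (shM C) (Mor C A B) (Mor C (shO C A) (shO C B))"
    and shM_ident: "A \<in> Ob C \<Longrightarrow> shM C (ident C A) = ident C (shO C A)"
    and shM_cmp: "\<lbrakk>f \<in> Mor C A B; g \<in> Mor C B D\<rbrakk> \<Longrightarrow> shM C (g \<cdot> f) = shM C g \<cdot> shM C f"
    and shM_add: "\<lbrakk>f \<in> Mor C A B; f' \<in> Mor C A B\<rbrakk>
          \<Longrightarrow> shM C (madd C f f') = madd C (shM C f) (shM C f')"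
    and shO_ess_surj: "B \<in> Ob C \<Longrightarrow> \<exists>A \<in> Ob C. isomorphic C (shO C A) B"
    and dtri_typed: "(f, g, h) \<in> dtri C
          \<Longrightarrow> \<exists>A B D. f \<in> Mor C A B \<and> g \<in> Mor C B D \<and> h \<in> Mor C D (shO C A)"
    and dtri_iso: "\<lbrakk>(f, g, h) \<in> dtri C;
            f \<in> Mor C A B; g \<in> Mor C B D; h \<in> Mor C D (shO C A);
            f' \<in> Mor C A' B'; g' \<in> Mor C B' D'; h' \<in> Mor C D' (shO C A');
            is_isomorphism C A A' a; is_isomorphism C B B' b; is_isomorphism C D D' d;
            b \<cdot> f = f' \<cdot> a; d \<cdot> g = g' \<cdot> b; shM C a \<cdot> h = h' \<cdot> d\<rbrakk>
          \<Longrightarrow> (f', g', h') \<in> dtri C"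
    and dtri_ident: "\<lbrakk>A \<in> Ob C; is_zero_object C Z\<rbrakk>
          \<Longrightarrow> (ident C A, mzero C A Z, mzero C Z (shO C A)) \<in> dtri C"
    and dtri_cone: "f \<in> Mor C A B \<Longrightarrow> \<exists>g h. (f, g, h) \<in> dtri C"
    and dtri_rotate: "\<lbrakk>f \<in> Mor C A B; g \<in> Mor C B D; h \<in> Mor C D (shO C A)\<rbrakk>
          \<Longrightarrow> (f, g, h) \<in> dtri C \<longleftrightarrow> (g, h, mneg C (shM C f)) \<in> dtri C"
    and dtri_morphism: "\<lbrakk>(f, g, h) \<in> dtri C; (f', g', h') \<in> dtri C;
            f \<in> Mor C A B; g \<in> Mor C B D; f' \<in> Mor C A' B'; g' \<in> Mor C B' D';
            a \<in> Mor C A A'; b \<in> Mor C B B'; b \<cdot> f = f' \<cdot> a\<rbrakk>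
          \<Longrightarrow> \<exists>d \<in> Mor C D D'. d \<cdot> g = g' \<cdot> b \<and> shM C a \<cdot> h = h' \<cdot> d"
    and octahedral: "\<lbrakk>f \<in> Mor C A B; g \<in> Mor C B D;
            (f, f', f'') \<in> dtri C; (g, g', g'') \<in> dtri C; (g \<cdot> f, k', k'') \<in> dtri C;
            f' \<in> Mor C B P; k' \<in> Mor C D Q; g' \<in> Mor C D R\<rbrakk>
          \<Longrightarrow> \<exists>u \<in> Mor C P Q. \<exists>v \<in> Mor C Q R.
                (u, v, shM C f' \<cdot> g'') \<in> dtri C \<and>
                u \<cdot> f' = k' \<cdot> g \<and> k'' \<cdot> u = f'' \<and> v \<cdot> k' = g' \<and> g'' \<cdot> v = shM C f \<cdot> k''"

definition idempotent_complete :: "('o, 'm, 'z) tricat_scheme \<Rightarrow> bool" where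
  "idempotent_complete C \<longleftrightarrow>
     (\<forall>A \<in> Ob C. \<forall>e \<in> Mor C A A. e \<cdot>\<^bsub>C\<^esub> e = e \<longrightarrow>
        (\<exists>B \<in> Ob C. \<exists>r \<in> Mor C A B. \<exists>s \<in> Mor C B A.
           s \<cdot>\<^bsub>C\<^esub> r = e \<and> r \<cdot>\<^bsub>C\<^esub> s = ident C B))"

abbreviation shiftO :: "('o, 'm, 'z) tricat_scheme \<Rightarrow> nat \<Rightarrow> 'o \<Rightarrow> 'o" where
  "shiftO C i A \<equiv> (shO C ^^ i) A"

abbreviation shiftM :: "('o, 'm, 'z) tricat_scheme \<Rightarrow> nat \<Rightarrow> 'm \<Rightarrow> 'm" where
  "shiftM C i f \<equiv> (shM C ^^ i) f"

section \<open>Cluster tilting subcategories\<close>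

text \<open>A full subcategory is given by its set of objects \<open>X\<close>.\<close>

definition functorially_finite :: "('o, 'm, 'z) tricat_scheme \<Rightarrow> 'o set \<Rightarrow> bool" where
  "functorially_finite C X \<longleftrightarrow>
     (\<forall>A \<in> Ob C.
        (\<exists>Y \<in> X. \<exists>g \<in> Mor C Y A. \<forall>Y' \<in> X. \<forall>x \<in> Mor C Y' A. \<exists>y \<in> Mor C Y' Y. x = g \<cdot>\<^bsub>C\<^esub> y) \<and>
        (\<exists>Y \<in> X. \<exists>f \<in> Mor C A Y. \<forall>Y' \<in> X. \<forall>x \<in> Mor C A Y'. \<exists>y \<in> Mor C Y Y'. x = y \<cdot>\<^bsub>C\<^esub> f))"

definition cluster_tilting :: "('o, 'm, 'z) tricat_scheme \<Rightarrow> nat \<Rightarrow> 'o set \<Rightarrow> bool" where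
  "cluster_tilting C n X \<longleftrightarrow>
     X \<subseteq> Ob C \<and> functorially_finite C X \<and>
     X = {A \<in> Ob C. \<forall>Y \<in> X. \<forall>i \<in> {1..n - 1}. Mor C Y (shiftO C i A) = {mzero C Y (shiftO C i A)}} \<and>
     X = {A \<in> Ob C. \<forall>Y \<in> X. \<forall>i \<in> {1..n - 1}. Mor C A (shiftO C i Y) = {mzero C A (shiftO C i Y)}}"

text \<open>
  The full subcategory $X[n]$. It is closed under isomorphisms because the suspension need not be
  surjective on objects.
\<close>

definition shifted_subcat :: "('o, 'm, 'z) tricat_scheme \<Rightarrow> nat \<Rightarrow> 'o set \<Rightarrow> 'o set" where
  "shifted_subcat C n X = {A \<in> Ob C. \<exists>Y \<in> X. isomorphic C A (shiftO C n Y)}"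

section \<open>Grothendieck groups\<close>

definition iso_class :: "('o, 'm, 'z) tricat_scheme \<Rightarrow> 'o set \<Rightarrow> 'o \<Rightarrow> 'o set" where
  "iso_class C S A = {B \<in> S. isomorphic C A B}"

text \<open>
  The abelian group generated by the isomorphism classes of the objects in \<open>S\<close> modulo
  $[A] - [B] + [D]$ for all \<open>(A, B, D)\<close> in \<open>T\<close>. As in HOL-Algebra, the resulting factor group is
  written multiplicatively.
\<close>

abbreviation iso_free :: "('o, 'm, 'z) tricat_scheme \<Rightarrow> 'o set \<Rightarrow> ('o set \<Rightarrow>\<^sub>0 int) monoid" where
  "iso_free C S \<equiv> free_Abelian_group (iso_class C S ` S)"

definition K0_relations ::
  "('o, 'm, 'z) tricat_scheme \<Rightarrow> 'o set \<Rightarrow> ('o \<times> 'o \<times> 'o) set \<Rightarrow> ('o set \<Rightarrow>\<^sub>0 int) set" where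
  "K0_relations C S T = generate (iso_free C S)
     {frag_of (iso_class C S A) - frag_of (iso_class C S B) + frag_of (iso_class C S D) | A B D.
        (A, B, D) \<in> T}"

definition K0_group ::
  "('o, 'm, 'z) tricat_scheme \<Rightarrow> 'o set \<Rightarrow> ('o \<times> 'o \<times> 'o) set \<Rightarrow> ('o set \<Rightarrow>\<^sub>0 int) set monoid" where
  "K0_group C S T = iso_free C S Mod K0_relations C S T"

definition K0_class ::
  "('o, 'm, 'z) tricat_scheme \<Rightarrow> 'o set \<Rightarrow> ('o \<times> 'o \<times> 'o) set \<Rightarrow> 'o \<Rightarrow> ('o set \<Rightarrow>\<^sub>0 int) set" where
  "K0_class C S T A = K0_relations C S T #>\<^bsub>iso_free C S\<^esub> frag_of (iso_class C S A)"

definition triangle_objects :: "('o, 'm, 'z) tricat_scheme \<Rightarrow> ('o \<times> 'o \<times> 'o) set" where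
  "triangle_objects C = {(A, B, D) | A B D. \<exists>f g h.
     f \<in> Mor C A B \<and> g \<in> Mor C B D \<and> h \<in> Mor C D (shO C A) \<and> (f, g, h) \<in> dtri C}"

definition K0 :: "('o, 'm, 'z) tricat_scheme \<Rightarrow> ('o set \<Rightarrow>\<^sub>0 int) set monoid" where
  "K0 C = K0_group C (Ob C) (triangle_objects C)"

definition cl :: "('o, 'm, 'z) tricat_scheme \<Rightarrow> 'o \<Rightarrow> ('o set \<Rightarrow>\<^sub>0 int) set" where
  "cl C A = K0_class C (Ob C) (triangle_objects C) A"

definition split_objects :: "('o, 'm, 'z) tricat_scheme \<Rightarrow> 'o set \<Rightarrow> ('o \<times> 'o \<times> 'o) set" where
  "split_objects C X = {(A, D, B) | A D B. A \<in> X \<and> D \<in> X \<and> B \<in> X \<and> is_biproduct C A B D}"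

definition K0_sp :: "('o, 'm, 'z) tricat_scheme \<Rightarrow> 'o set \<Rightarrow> ('o set \<Rightarrow>\<^sub>0 int) set monoid" where
  "K0_sp C X = K0_group C X (split_objects C X)"

definition cl_sp :: "('o, 'm, 'z) tricat_scheme \<Rightarrow> 'o set \<Rightarrow> 'o \<Rightarrow> ('o set \<Rightarrow>\<^sub>0 int) set" where
  "cl_sp C X A = K0_class C X (split_objects C X) A"

text \<open>The sum $\sum_{i<k} (-1)^i [Y_i]$ in the split Grothendieck group.\<close>

definition alt_sum_sp ::
  "('o, 'm, 'z) tricat_scheme \<Rightarrow> 'o set \<Rightarrow> nat \<Rightarrow> (nat \<Rightarrow> 'o) \<Rightarrow> ('o set \<Rightarrow>\<^sub>0 int) set" where
  "alt_sum_sp C X k Y =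
     (\<Otimes>\<^bsub>K0_sp C X\<^esub>i\<in>{..<k}. cl_sp C X (Y i) [^]\<^bsub>K0_sp C X\<^esub> ((-1) ^ i :: int))"

section \<open>The relative extriangulated structure and the index\<close>

definition E_R :: "('o, 'm, 'z) tricat_scheme \<Rightarrow> 'o set \<Rightarrow> 'o \<Rightarrow> 'o \<Rightarrow> 'm set" where
  "E_R C X D A = {h \<in> Mor C D (shO C A).
     \<forall>Y \<in> X. \<forall>x \<in> Mor C Y D. h \<cdot>\<^bsub>C\<^esub> x = mzero C Y (shO C A)}"

definition conflation_R ::
  "('o, 'm, 'z) tricat_scheme \<Rightarrow> 'o set \<Rightarrow> 'o \<Rightarrow> 'o \<Rightarrow> 'o \<Rightarrow> 'm \<Rightarrow> 'm \<Rightarrow> bool" where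
  "conflation_R C X A B D f g \<longleftrightarrow>
     f \<in> Mor C A B \<and> g \<in> Mor C B D \<and> (\<exists>h \<in> E_R C X D A. (f, g, h) \<in> dtri C)"

definition conflation_objects :: "('o, 'm, 'z) tricat_scheme \<Rightarrow> 'o set \<Rightarrow> ('o \<times> 'o \<times> 'o) set" where
  "conflation_objects C X = {(A, B, D) | A B D. \<exists>f g. conflation_R C X A B D f g}"

definition K0_R :: "('o, 'm, 'z) tricat_scheme \<Rightarrow> 'o set \<Rightarrow> ('o set \<Rightarrow>\<^sub>0 int) set monoid" where
  "K0_R C X = K0_group C (Ob C) (conflation_objects C X)"

definition cl_R :: "('o, 'm, 'z) tricat_scheme \<Rightarrow> 'o set \<Rightarrow> 'o \<Rightarrow> ('o set \<Rightarrow>\<^sub>0 int) set" where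
  "cl_R C X A = K0_class C (Ob C) (conflation_objects C X) A"

text \<open>
  \<open>Y (n - 1), \<dots>, Y 0\<close> are the terms of a resolution of \<open>A\<close> spliced from conflations
  \<open>D (i + 1) \<rightarrow> Y i \<rightarrow> D i\<close> for $0 \le i \le n - 2$.
\<close>

definition is_resolution ::
  "('o, 'm, 'z) tricat_scheme \<Rightarrow> nat \<Rightarrow> 'o set \<Rightarrow> 'o \<Rightarrow> (nat \<Rightarrow> 'o) \<Rightarrow> bool" where
  "is_resolution C n X A Y \<longleftrightarrow> (\<forall>i < n. Y i \<in> X) \<and>
     (\<exists>D. D 0 = A \<and> D (n - 1) = Y (n - 1) \<and>
        (\<forall>i < n - 1. \<exists>f g. conflation_R C X (D (i + 1)) (Y i) (D i) f g))"

definition is_index_isomorphism ::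
  "('o, 'm, 'z) tricat_scheme \<Rightarrow> nat \<Rightarrow> 'o set \<Rightarrow>
     (('o set \<Rightarrow>\<^sub>0 int) set \<Rightarrow> ('o set \<Rightarrow>\<^sub>0 int) set) \<Rightarrow> bool" where
  "is_index_isomorphism C n X \<phi> \<longleftrightarrow>
     \<phi> \<in> iso (K0_R C X) (K0_sp C X) \<and> \<phi> \<in> extensional (carrier (K0_R C X)) \<and>
     (\<forall>A \<in> Ob C. \<forall>Y. is_resolution C n X A Y \<longrightarrow> \<phi> (cl_R C X A) = alt_sum_sp C X n Y)"

text \<open>
  As every object has a resolution, the values on the generators are prescribed, so that there is
  at most one index isomorphism.
\<close>

definition index ::
  "('o, 'm, 'z) tricat_scheme \<Rightarrow> nat \<Rightarrow> 'o set \<Rightarrow> ('o set \<Rightarrow>\<^sub>0 int) set \<Rightarrow> ('o set \<Rightarrow>\<^sub>0 int) set" where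
  "index C n X = (THE \<phi>. is_index_isomorphism C n X \<phi>)"

section \<open>The angulated structure\<close>

text \<open>
  The composite $t_k[k-1] \circ \dots \circ t_2[1] \circ t_1$, starting at the object \<open>A\<close>.
\<close>

fun connecting :: "('o, 'm, 'z) tricat_scheme \<Rightarrow> 'o \<Rightarrow> (nat \<Rightarrow> 'm) \<Rightarrow> nat \<Rightarrow> 'm" where
  "connecting C A t 0 = ident C A"
| "connecting C A t (Suc k) = shiftM C k (t (Suc k)) \<cdot>\<^bsub>C\<^esub> connecting C A t k"

text \<open>
  \<open>is_angle C n X Y d h\<close>: the sequence
  $Y_{n+1} \to Y_n \to \dots \to Y_1 \to Y_0 \to Y_{n+1}[n]$ with arrows
  \<open>d i : Y (i + 1) \<rightarrow> Y i\<close> and last arrow \<open>h\<close> is an $(n+2)$-angle of $(X, [n])$.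
\<close>

definition is_angle ::
  "('o, 'm, 'z) tricat_scheme \<Rightarrow> nat \<Rightarrow> 'o set \<Rightarrow> (nat \<Rightarrow> 'o) \<Rightarrow> (nat \<Rightarrow> 'm) \<Rightarrow> 'm \<Rightarrow> bool" where
  "is_angle C n X Y d h \<longleftrightarrow> (\<forall>i \<le> n + 1. Y i \<in> X) \<and>
     (\<exists>D f g t.
        D 1 = Y 0 \<and> D (n + 1) = Y (n + 1) \<and>
        (\<forall>i \<in> {1..n}. f i \<in> Mor C (D (i + 1)) (Y i) \<and> g i \<in> Mor C (Y i) (D i) \<and>
           t i \<in> Mor C (D i) (shO C (D (i + 1))) \<and> (f i, g i, t i) \<in> dtri C) \<and>
        d n = f n \<and>
        (\<forall>i \<in> {1..n - 1}. d i = f i \<cdot>\<^bsub>C\<^esub> g (i + 1)) \<and>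
        d 0 = g 1 \<and>
        h = connecting C (Y 0) t n)"

definition angle_relations :: "('o, 'm, 'z) tricat_scheme \<Rightarrow> nat \<Rightarrow> 'o set \<Rightarrow> ('o set \<Rightarrow>\<^sub>0 int) set set"
  where
  "angle_relations C n X =
     generate (K0_sp C X) {alt_sum_sp C X (n + 2) Y | Y. \<exists>d h. is_angle C n X Y d h}"

definition K0_ang ::
  "('o, 'm, 'z) tricat_scheme \<Rightarrow> nat \<Rightarrow> 'o set \<Rightarrow> ('o set \<Rightarrow>\<^sub>0 int) set set monoid" where
  "K0_ang C n X = K0_sp C X Mod angle_relations C n X"

definition proj_ang ::
  "('o, 'm, 'z) tricat_scheme \<Rightarrow> nat \<Rightarrow> 'o set \<Rightarrow>
     ('o set \<Rightarrow>\<^sub>0 int) set \<Rightarrow> ('o set \<Rightarrow>\<^sub>0 int) set set" where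
  "proj_ang C n X a = angle_relations C n X #>\<^bsub>K0_sp C X\<^esub> a"

end

theory Submission
  imports Defs
begin

text \<open>
  The proof rests on one consequence of the octahedral axiom (\<open>triangle_pullback\<close>): triangles
  \<open>A \<rightarrow> B \<rightarrow> D\<close> and \<open>D' \<rightarrow> Y \<rightarrow> D\<close> have a homotopy pullback \<open>E\<close> with triangles \<open>D' \<rightarrow> E \<rightarrow> B\<close> and
  \<open>A \<rightarrow> E \<rightarrow> Y\<close>. If \<open>D' \<rightarrow> Y \<rightarrow> D\<close> is a conflation, then so is \<open>D' \<rightarrow> E \<rightarrow> B\<close>. If moreover \<open>Y\<close> lies in
  \<open>X\<close> and \<open>A \<rightarrow> B \<rightarrow> D\<close> is a conflation, then \<open>E\<close> is the biproduct of \<open>A\<close> and \<open>Y\<close>.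

  The index isomorphism. Right approximations by \<open>X\<close> yield conflations, and after \<open>n - 1\<close> of them the
  syzygy lies in \<open>X\<close> because of the vanishing that defines cluster tilting. The alternating sum over a
  resolution is additive on conflations, by an argument like Schanuel's lemma with four pullbacks
  (\<open>index_value_additive\<close>); its independence of the resolution is the special case of the conflation of
  an isomorphism. So the index is a homomorphism on the Grothendieck group of the conflations, and
  \<open>[Y] \<mapsto> [Y]\<close> is its inverse, since the sum over a resolution telescopes (\<open>hom_from_Ksp\<close>).

  Triangles and angles. An angle is spliced from triangles, so its alternating sum telescopes to zero
  in $K_0(\mathcal{C})$ (\<open>angle_sum_vanishes\<close>), and \<open>[Y] \<mapsto> [Y]\<close> factors over
  $K_0^{\mathrm{ang}}(\mathcal{X})$. For an inverse, the index of \<open>B\<close> must be the sum of those of \<open>A\<close> and \<open>D\<close>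
  modulo angles, for every triangle \<open>A \<rightarrow> B \<rightarrow> D\<close> (\<open>ang_class_triangle\<close>). Pulling the triangle back along
  an approximation of \<open>D\<close>, and then its left rotation along an approximation of \<open>B\<close>, changes the
  relation only by those of conflations, on which the index is additive. This reduces the claim to \<open>B\<close>
  and \<open>D\<close> in \<open>X\<close>. Such a triangle spliced with a resolution of \<open>A\<close> is an \<open>(n + 2)\<close>-angle, and
  the vanishing of its alternating sum is the relation.
\<close>

section \<open>Quotients of abelian groups by generated subgroups\<close>

locale quotient_by_relations = comm_group G for G (structure) +
  fixes R :: "'a set"
  assumes relations_closed: "R \<subseteq> carrier G"
begin

abbreviation Q where "Q \<equiv> G Mod generate G R"

abbreviation quot where "quot x \<equiv> generate G R #> x"

lemma normal_relations: "generate G R \<lhd> G"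
  by (simp add: generate_is_subgroup relations_closed subgroup_imp_normal)

lemma comm_group_quotient: "comm_group Q"
  by (simp add: abelian_FactGroup generate_is_subgroup relations_closed)

lemma quot_hom: "(\<lambda>x. quot x) \<in> hom G Q"
  using normal.r_coset_hom_Mod[OF normal_relations] .

lemma quot_closed: "x \<in> carrier G \<Longrightarrow> quot x \<in> carrier Q"
  using quot_hom by (simp add: hom_in_carrier)

lemma quot_surj: "q \<in> carrier Q \<Longrightarrow> \<exists>x \<in> carrier G. q = quot x"
  by (auto simp: FactGroup_def RCOSETS_def)

lemma quot_relation: "r \<in> R \<Longrightarrow> quot r = \<one>\<^bsub>Q\<^esub>"
  by (simp add: generate.incl generate_is_subgroup relations_closed subgroup.rcos_const is_group)

lemma quotient_universal:
  assumes "group H" "h \<in> hom G H" "\<And>r. r \<in> R \<Longrightarrow> h r = \<one>\<^bsub>H\<^esub>"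
  obtains g where "g \<in> hom Q H" "\<And>x. x \<in> carrier G \<Longrightarrow> g (quot x) = h x"
proof -
  interpret h: group_hom G H h
    using assms by (simp add: group_hom_def group_hom_axioms_def is_group)
  have "generate G R \<subseteq> kernel G H h"
    by (rule generate_subgroup_incl[OF _ h.subgroup_kernel])
      (use assms(3) relations_closed in \<open>auto simp: kernel_def\<close>)
  with h.FactGroup_universal_kernel[OF normal_relations] that show thesis by blast
qed

end

text \<open>Only the generators are compared in the Grothendieck groups below, so equality of homomorphisms is
  always reduced to this.\<close>

lemma hom_eq_on_free:
  assumes "group G" "f \<in> hom (free_Abelian_group S) G" "g \<in> hom (free_Abelian_group S) G"
    and "\<And>x. x \<in> S \<Longrightarrow> f (frag_of x) = g (frag_of x)"
    and c: "c \<in> carrier (free_Abelian_group S)"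
  shows "f c = g c"
proof -
  let ?F = "free_Abelian_group S"
  interpret f: group_hom ?F G f using assms by (simp add: group_hom_def group_hom_axioms_def)
  interpret g: group_hom ?F G g using assms by (simp add: group_hom_def group_hom_axioms_def)
  from c have "Poly_Mapping.keys c \<subseteq> S" by simp
  then show ?thesis
  proof (rule free_Abelian_group_induct[where P = "\<lambda>c. f c = g c"])
    show "f 0 = g 0" using f.hom_one g.hom_one by simp
  next
    fix x y
    assume 2: "Poly_Mapping.keys x \<subseteq> S" "Poly_Mapping.keys y \<subseteq> S" "f x = g x" "f y = g y"
    have "h (x - y) = h x \<otimes>\<^bsub>G\<^esub> inv\<^bsub>G\<^esub> h y" if "group_hom ?F G h" for h
      using group_hom.hom_mult[OF that, of x "-y"] group_hom.hom_inv[OF that, of y] 2 by simp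
    from this[OF f.group_hom_axioms] this[OF g.group_hom_axioms]
    show "f (x - y) = g (x - y)" using 2 by simp
  qed (use assms in auto)
qed

lemma inverse_homs_imp_iso:
  assumes "f \<in> hom G H" "g \<in> hom H G"
    and "\<And>x. x \<in> carrier G \<Longrightarrow> g (f x) = x" "\<And>y. y \<in> carrier H \<Longrightarrow> f (g y) = y"
  shows "f \<in> iso G H"
  by (rule isoI[OF assms(1)], rule bij_betw_byWitness[where f' = g])
    (use assms in \<open>auto simp: hom_in_carrier\<close>)

section \<open>Grothendieck groups of a set of objects with relations\<close>

definition alt_prod :: "('a, 'b) monoid_scheme \<Rightarrow> nat \<Rightarrow> (nat \<Rightarrow> 'a) \<Rightarrow> 'a" where
  "alt_prod G k a = (\<Otimes>\<^bsub>G\<^esub>i\<in>{..<k}. a i [^]\<^bsub>G\<^esub> ((-1) ^ i :: int))"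

context comm_group
begin

lemma alt_prod_0 [simp]: "alt_prod G 0 a = \<one>"
  by (simp add: alt_prod_def)

lemma alt_prod_closed [simp]:
  "(\<And>i. i < k \<Longrightarrow> a i \<in> carrier G) \<Longrightarrow> alt_prod G k a \<in> carrier G"
  by (auto simp: alt_prod_def intro!: finprod_closed)

text \<open>The recursion peels off the first factor, the way a resolution of an object consists of an
  approximation and a resolution of its first syzygy.\<close>

lemma alt_prod_Suc:
  assumes "\<And>i. i < Suc k \<Longrightarrow> a i \<in> carrier G"
  shows "alt_prod G (Suc k) a = a 0 \<otimes> inv alt_prod G k (\<lambda>i. a (Suc i))"
  using assms
proof (induction k)
  case 0
  then show ?case by (simp add: alt_prod_def lessThan_Suc)
next
  case (Suc k)
  have a: "a i \<in> carrier G" if "i < Suc (Suc k)" for i using Suc.prems that by blast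
  have last: "alt_prod G (Suc j) b = b j [^] ((-1) ^ j :: int) \<otimes> alt_prod G j b"
    if "\<And>i. i < Suc j \<Longrightarrow> b i \<in> carrier G" for j b
    unfolding alt_prod_def lessThan_Suc
    by (rule finprod_insert) (use that in auto)
  let ?c = "alt_prod G k (\<lambda>i. a (Suc i))" and ?e = "a (Suc k) [^] ((-1) ^ k :: int)"
  have c: "?c \<in> carrier G" "?e \<in> carrier G" using a by auto
  have "alt_prod G (Suc (Suc k)) a = inv ?e \<otimes> (a 0 \<otimes> inv ?c)"
    using Suc.IH[OF a] last[OF a] a by (simp add: int_pow_neg)
  also have "\<dots> = a 0 \<otimes> inv (?e \<otimes> ?c)"
    using c a[of 0] by (simp add: inv_mult m_assoc m_lcomm)
  also have "?e \<otimes> ?c = alt_prod G (Suc k) (\<lambda>i. a (Suc i))"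
    by (rule last[symmetric]) (use a in auto)
  finally show ?case .
qed

lemma alt_prod_hom:
  assumes "comm_group H" "h \<in> hom G H" "\<And>i. i < k \<Longrightarrow> a i \<in> carrier G"
  shows "h (alt_prod G k a) = alt_prod H k (\<lambda>i. h (a i))"
proof -
  interpret H: comm_group H by fact
  interpret h: group_hom G H h
    using assms by (simp add: group_hom_def group_hom_axioms_def is_group H.is_group)
  show ?thesis
    using assms(3)
  proof (induction k arbitrary: a)
    case 0
    then show ?case by simp
  next
    case (Suc k)
    have "a (Suc i) \<in> carrier G" if "i < k" for i using Suc.prems that by simp
    with Suc show ?case by (simp add: alt_prod_Suc H.alt_prod_Suc)
  qed
qed

text \<open>Splicing: neighbouring terms share a summand, which cancels.\<close>

lemma alt_prod_telescope:
  assumes "\<And>i. i \<le> k \<Longrightarrow> d i \<in> carrier G" "\<And>i. i < k \<Longrightarrow> a i = d i \<otimes> d (Suc i)" "a k = d k"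
  shows "alt_prod G (Suc k) a = d 0"
  using assms
proof (induction k arbitrary: a d)
  case 0
  then show ?case by (subst alt_prod_Suc) simp_all
next
  case (Suc k)
  have "alt_prod G (Suc k) (\<lambda>i. a (Suc i)) = d (Suc 0)"
    using Suc.IH[of "\<lambda>i. d (Suc i)" "\<lambda>i. a (Suc i)"] Suc.prems by simp
  moreover have "a i \<in> carrier G" if "i < Suc (Suc k)" for i
    using Suc.prems that by (cases "i = Suc k") auto
  moreover have "a 0 = d 0 \<otimes> d (Suc 0)" using Suc.prems(2) by simp
  ultimately show ?case using Suc.prems(1)[of 0] Suc.prems(1)[of "Suc 0"]
    by (subst alt_prod_Suc) (auto simp: m_assoc)
qed

end

text \<open>It turns a relation between syzygies into one between the indices of their objects, which are
  differences of an approximation and a syzygy.\<close>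

lemma (in comm_group) rearrange_differences:
  assumes eq: "b \<otimes> (w \<otimes> u) = a \<otimes> (d \<otimes> v)"
    and c: "u \<in> carrier G" "v \<in> carrier G" "w \<in> carrier G"
      "a \<in> carrier G" "b \<in> carrier G" "d \<in> carrier G"
  shows "v \<otimes> inv b = (u \<otimes> inv a) \<otimes> (w \<otimes> inv d)"
proof -
  have "b \<otimes> (a \<otimes> d) \<otimes> ((u \<otimes> inv a) \<otimes> (w \<otimes> inv d))
      = (a \<otimes> inv a) \<otimes> ((d \<otimes> inv d) \<otimes> (b \<otimes> (w \<otimes> u)))"
    by (simp only: m_ac c m_closed inv_closed)
  also have "\<dots> = a \<otimes> (d \<otimes> v)" using c eq by simp
  also have "\<dots> = (b \<otimes> inv b) \<otimes> (a \<otimes> (d \<otimes> v))" using c by simp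
  also have "\<dots> = b \<otimes> (a \<otimes> d) \<otimes> (v \<otimes> inv b)" by (simp only: m_ac c m_closed inv_closed)
  finally show ?thesis using c by simp
qed

lemma alt_sum_sp_alt_prod: "alt_sum_sp C X k Y = alt_prod (K0_sp C X) k (\<lambda>i. cl_sp C X (Y i))"
  by (simp add: alt_sum_sp_def alt_prod_def)

text \<open>The common part of the groups $K_0(\mathcal{C})$, $K_0(\mathcal{C}^{\mathcal{X}}_R)$ and
  $K_0^{\mathsf{sp}}(\mathcal{X})$, which differ in \<open>S\<close> and \<open>T\<close> only.\<close>

locale object_relations =
  fixes C :: "('o, 'm, 'z) tricat_scheme" and S :: "'o set" and T :: "('o \<times> 'o \<times> 'o) set"
  assumes relation_objects: "(A, B, D) \<in> T \<Longrightarrow> A \<in> S \<and> B \<in> S \<and> D \<in> S"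
begin

definition "relators = {frag_of (iso_class C S A) - frag_of (iso_class C S B)
  + frag_of (iso_class C S D) | A B D. (A, B, D) \<in> T}"

sublocale quotient_by_relations "iso_free C S" relators
proof -
  have "relators \<subseteq> carrier (iso_free C S)"
  proof
    fix r assume "r \<in> relators"
    then obtain A B D where r: "r = frag_of (iso_class C S A) - frag_of (iso_class C S B)
        + frag_of (iso_class C S D)" and "(A, B, D) \<in> T"
      by (auto simp: relators_def)
    then have "A \<in> S" "B \<in> S" "D \<in> S" using relation_objects by auto
    then show "r \<in> carrier (iso_free C S)"
      using keys_add[of "frag_of (iso_class C S A) - frag_of (iso_class C S B)" "frag_of (iso_class C S D)"]
        keys_diff[of "frag_of (iso_class C S A)" "frag_of (iso_class C S B)"]
      by (auto simp: r)
  qed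
  then show "quotient_by_relations (iso_free C S) relators"
    by (simp add: quotient_by_relations_def quotient_by_relations_axioms_def
        abelian_free_Abelian_group)
qed

lemma K0_group_eq: "K0_group C S T = Q"
  by (simp add: K0_group_def K0_relations_def relators_def)

lemma K0_class_eq: "K0_class C S T A = quot (frag_of (iso_class C S A))"
  by (simp add: K0_class_def K0_relations_def relators_def)

lemma comm_group_K0: "comm_group (K0_group C S T)"
  unfolding K0_group_eq by (rule comm_group_quotient)

lemma K0_class_closed: "A \<in> S \<Longrightarrow> K0_class C S T A \<in> carrier (K0_group C S T)"
  unfolding K0_group_eq K0_class_eq by (rule quot_closed) simp

lemma K0_class_relation:
  assumes "(A, B, D) \<in> T"
  shows "K0_class C S T B = K0_class C S T A \<otimes>\<^bsub>K0_group C S T\<^esub> K0_class C S T D"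
proof -
  interpret Q: comm_group Q by (rule comm_group_quotient)
  interpret q: group_hom "iso_free C S" Q "\<lambda>x. quot x"
    by (simp add: group_hom_def group_hom_axioms_def quot_hom is_group Q.is_group)
  let ?f = "\<lambda>A. frag_of (iso_class C S A)"
  have S: "A \<in> S" "B \<in> S" "D \<in> S" using relation_objects[OF assms] by auto
  have mem: "?f A - ?f B + ?f D \<in> relators" using assms by (auto simp: relators_def)
  have qc: "\<And>E. E \<in> S \<Longrightarrow> quot (?f E) \<in> carrier Q" by (rule quot_closed) simp
  have k: "Poly_Mapping.keys (?f A - ?f B + ?f D) \<subseteq> iso_class C S ` S"
    using subsetD[OF relations_closed mem] by simp
  have "quot (?f A) \<otimes>\<^bsub>Q\<^esub> quot (?f D) = quot (?f A + ?f D)"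
    using q.hom_mult[of "?f A" "?f D"] S by simp
  also have "?f A + ?f D = (?f A - ?f B + ?f D) + ?f B" by simp
  also have "quot \<dots> = quot (?f A - ?f B + ?f D) \<otimes>\<^bsub>Q\<^esub> quot (?f B)"
    using q.hom_mult[of "?f A - ?f B + ?f D" "?f B"] k S by simp
  also have "\<dots> = quot (?f B)" using quot_relation[OF mem] qc[OF S(2)] Q.l_one by metis
  finally show ?thesis unfolding K0_group_eq K0_class_eq by simp
qed

lemma K0_universal:
  assumes H: "comm_group H"
    and closed: "\<And>A. A \<in> S \<Longrightarrow> v A \<in> carrier H"
    and iso: "\<And>A B. \<lbrakk>A \<in> S; B \<in> S; iso_class C S A = iso_class C S B\<rbrakk> \<Longrightarrow> v A = v B"
    and rel: "\<And>A B D. (A, B, D) \<in> T \<Longrightarrow> v B = v A \<otimes>\<^bsub>H\<^esub> v D"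
  obtains g where "g \<in> hom (K0_group C S T) H" "\<And>A. A \<in> S \<Longrightarrow> g (K0_class C S T A) = v A"
proof -
  interpret H: comm_group H by fact
  define w where "w c = v (SOME B. B \<in> S \<and> iso_class C S B = c)" for c
  have w: "w (iso_class C S A) = v A" if "A \<in> S" for A
    unfolding w_def
    by (rule someI2[of _ A]) (use that in \<open>auto intro: iso\<close>)
  obtain h where h: "h \<in> hom (iso_free C S) H"
    and hw: "\<And>x. x \<in> iso_class C S ` S \<Longrightarrow> h (frag_of x) = w x"
    by (rule H.free_Abelian_group_universal[of w "iso_class C S ` S"]) (use w closed in auto)
  have hv: "h (frag_of (iso_class C S A)) = v A" if "A \<in> S" for A
    using hw w that by simp
  interpret h: group_hom "iso_free C S" H h
    using h by (simp add: group_hom_def group_hom_axioms_def is_group H.is_group)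
  have "h r = \<one>\<^bsub>H\<^esub>" if r: "r \<in> relators" for r
  proof -
    obtain A B D where rd: "r = frag_of (iso_class C S A) - frag_of (iso_class C S B)
        + frag_of (iso_class C S D)" and T: "(A, B, D) \<in> T"
      using r by (auto simp: relators_def)
    have S: "A \<in> S" "B \<in> S" "D \<in> S" using relation_objects[OF T] by auto
    let ?f = "\<lambda>A. frag_of (iso_class C S A)"
    have rc: "r \<in> carrier (iso_free C S)" using r relations_closed by blast
    have f: "?f A \<in> carrier (iso_free C S)" "?f B \<in> carrier (iso_free C S)"
      "?f D \<in> carrier (iso_free C S)" using S by auto
    have "r + ?f B = ?f A + ?f D" using rd by simp
    then have "h r \<otimes>\<^bsub>H\<^esub> v B = v A \<otimes>\<^bsub>H\<^esub> v D"
      using h.hom_mult[OF rc f(2)] h.hom_mult[OF f(1,3)] hv[OF S(1)] hv[OF S(2)] hv[OF S(3)]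
      by (simp only: mult_free_Abelian_group)
    then have "h r \<otimes>\<^bsub>H\<^esub> v B = v B" using rel[OF T] by (simp only:)
    then show ?thesis using h.hom_closed[OF rc] closed[OF S(2)] by simp
  qed
  from quotient_universal[OF H.is_group h this]
  obtain g where g: "g \<in> hom Q H" "\<And>x. x \<in> carrier (iso_free C S) \<Longrightarrow> g (quot x) = h x"
    by metis
  show thesis
    by (rule that[of g]) (use g hv in \<open>auto simp: K0_group_eq K0_class_eq\<close>)
qed

lemma K0_hom_eqI:
  assumes H: "group H" and f: "f \<in> hom (K0_group C S T) H" and g: "g \<in> hom (K0_group C S T) H"
    and eq: "\<And>A. A \<in> S \<Longrightarrow> f (K0_class C S T A) = g (K0_class C S T A)"
    and x: "x \<in> carrier (K0_group C S T)"
  shows "f x = g x"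
proof -
  obtain c where c: "c \<in> carrier (iso_free C S)" and xc: "x = quot c"
    using x quot_surj unfolding K0_group_eq by blast
  have "f \<circ> (\<lambda>x. quot x) \<in> hom (iso_free C S) H" "g \<circ> (\<lambda>x. quot x) \<in> hom (iso_free C S) H"
    using Group.hom_compose[OF quot_hom f[unfolded K0_group_eq]]
      Group.hom_compose[OF quot_hom g[unfolded K0_group_eq]]
    by simp_all
  from hom_eq_on_free[OF H this _ c] eq xc show ?thesis by (auto simp: K0_class_eq)
qed

end

section \<open>Arithmetic of morphisms\<close>

context additive_category
begin

lemma Mor_objects: "f \<in> Mor C A B \<Longrightarrow> A \<in> Ob C \<and> B \<in> Ob C"
  using src_tgt by (auto simp: Mor_def)

lemma Mor_unique: "\<lbrakk>f \<in> Mor C A B; f \<in> Mor C A' B'\<rbrakk> \<Longrightarrow> A = A' \<and> B = B'"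
  by (auto simp: Mor_def)

lemma zero_closed: "\<lbrakk>A \<in> Ob C; B \<in> Ob C\<rbrakk> \<Longrightarrow> mzero C A B \<in> Mor C A B"
  using comm_group.axioms(2)[OF Mor_comm_group] group.is_monoid monoid.one_closed
  by (fastforce simp: Mor_group_def)

lemma add_closed: "\<lbrakk>f \<in> Mor C A B; g \<in> Mor C A B\<rbrakk> \<Longrightarrow> madd C f g \<in> Mor C A B"
  using monoid.m_closed[OF group.is_monoid[OF comm_group.axioms(2)[OF Mor_comm_group]], of A B f g]
    Mor_objects[of f A B] by (simp add: Mor_group_def)

lemma neg_closed: "f \<in> Mor C A B \<Longrightarrow> mneg C f \<in> Mor C A B"
  using group.inv_closed[OF comm_group.axioms(2)[OF Mor_comm_group], of A B f]
    Mor_objects[of f A B] by (auto simp: Mor_group_def mneg_def Mor_def)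

lemma add_assoc: "\<lbrakk>f \<in> Mor C A B; g \<in> Mor C A B; h \<in> Mor C A B\<rbrakk>
    \<Longrightarrow> madd C (madd C f g) h = madd C f (madd C g h)"
  using monoid.m_assoc[OF group.is_monoid[OF comm_group.axioms(2)[OF Mor_comm_group]], of A B f g h]
    Mor_objects[of f A B] by (simp add: Mor_group_def)

lemma add_commute: "\<lbrakk>f \<in> Mor C A B; g \<in> Mor C A B\<rbrakk> \<Longrightarrow> madd C f g = madd C g f"
  using comm_monoid.m_comm[OF comm_group.axioms(1)[OF Mor_comm_group], of A B f g]
    Mor_objects[of f A B] by (simp add: Mor_group_def)

lemma zero_add: "f \<in> Mor C A B \<Longrightarrow> madd C (mzero C A B) f = f"
  using monoid.l_one[OF group.is_monoid[OF comm_group.axioms(2)[OF Mor_comm_group]], of A B f]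
    Mor_objects[of f A B] by (simp add: Mor_group_def)

lemma add_zero: "f \<in> Mor C A B \<Longrightarrow> madd C f (mzero C A B) = f"
  by (metis Mor_objects add_commute zero_add zero_closed)

lemma neg_add: "f \<in> Mor C A B \<Longrightarrow> madd C (mneg C f) f = mzero C A B"
  using group.l_inv[OF comm_group.axioms(2)[OF Mor_comm_group], of A B f]
    Mor_objects[of f A B] by (auto simp: Mor_group_def mneg_def Mor_def)

lemma add_neg: "f \<in> Mor C A B \<Longrightarrow> madd C f (mneg C f) = mzero C A B"
  by (metis add_commute neg_add neg_closed)

lemma add_left_cancel:
  "\<lbrakk>f \<in> Mor C A B; g \<in> Mor C A B; h \<in> Mor C A B; madd C f g = madd C f h\<rbrakk> \<Longrightarrow> g = h"
  using add_assoc[OF neg_closed, of f A B f g] add_assoc[OF neg_closed, of f A B f h]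
    neg_add[of f A B] zero_add[of g A B] zero_add[of h A B] by simp

lemma neg_unique: "\<lbrakk>f \<in> Mor C A B; g \<in> Mor C A B; madd C f g = mzero C A B\<rbrakk> \<Longrightarrow> g = mneg C f"
  using add_left_cancel[of f A B g "mneg C f"] add_neg[of f A B] neg_closed[of f A B] by simp

lemma neg_neg: "f \<in> Mor C A B \<Longrightarrow> mneg C (mneg C f) = f"
  using neg_unique[of "mneg C f" A B f] neg_add[of f A B] neg_closed[of f A B] by simp

lemma neg_zero: "\<lbrakk>A \<in> Ob C; B \<in> Ob C\<rbrakk> \<Longrightarrow> mneg C (mzero C A B) = mzero C A B"
  using neg_unique[of "mzero C A B" A B "mzero C A B"] zero_add zero_closed by simp

lemma diff_zero_imp_eq:
  "\<lbrakk>f \<in> Mor C A B; g \<in> Mor C A B; madd C f (mneg C g) = mzero C A B\<rbrakk> \<Longrightarrow> f = g"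
  using neg_unique[OF neg_closed, of g A B f] add_commute[of f A B "mneg C g"] neg_neg[of g A B]
    neg_closed[of g A B] by simp

lemma cmp_zero_right:
  assumes "g \<in> Mor C B D" "A \<in> Ob C"
  shows "g \<cdot> mzero C A B = mzero C A D"
proof -
  have z: "mzero C A B \<in> Mor C A B" using assms Mor_objects zero_closed by blast
  have c: "g \<cdot> mzero C A B \<in> Mor C A D" using z assms(1) by (rule cmp_closed)
  have "madd C (g \<cdot> mzero C A B) (g \<cdot> mzero C A B) = g \<cdot> mzero C A B"
    using cmp_add_right[OF z z assms(1)] zero_add[OF z] by simp
  then show ?thesis using add_left_cancel[OF c c zero_closed] add_zero[OF c] Mor_objects[OF c] by auto
qed

lemma cmp_zero_left:
  assumes "f \<in> Mor C A B" "D \<in> Ob C"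
  shows "mzero C B D \<cdot> f = mzero C A D"
proof -
  have z: "mzero C B D \<in> Mor C B D" using assms Mor_objects zero_closed by blast
  have c: "mzero C B D \<cdot> f \<in> Mor C A D" using assms(1) z by (rule cmp_closed)
  have "madd C (mzero C B D \<cdot> f) (mzero C B D \<cdot> f) = mzero C B D \<cdot> f"
    using cmp_add_left[OF assms(1) z z] zero_add[OF z] by simp
  then show ?thesis using add_left_cancel[OF c c zero_closed] add_zero[OF c] Mor_objects[OF c] by auto
qed

lemma cmp_neg_right:
  assumes f: "f \<in> Mor C A B" and g: "g \<in> Mor C B D"
  shows "g \<cdot> mneg C f = mneg C (g \<cdot> f)"
proof (rule neg_unique)
  show "g \<cdot> f \<in> Mor C A D" "g \<cdot> mneg C f \<in> Mor C A D"
    using f neg_closed[OF f] g cmp_closed by blast+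
  show "madd C (g \<cdot> f) (g \<cdot> mneg C f) = mzero C A D"
    using cmp_add_right[OF f neg_closed[OF f] g] add_neg[OF f] cmp_zero_right[OF g] Mor_objects[OF f]
    by simp
qed

lemma cmp_neg_left:
  assumes f: "f \<in> Mor C A B" and g: "g \<in> Mor C B D"
  shows "mneg C g \<cdot> f = mneg C (g \<cdot> f)"
proof (rule neg_unique)
  show "g \<cdot> f \<in> Mor C A D" "mneg C g \<cdot> f \<in> Mor C A D"
    using f neg_closed[OF g] g cmp_closed by blast+
  show "madd C (g \<cdot> f) (mneg C g \<cdot> f) = mzero C A D"
    using cmp_add_left[OF f g neg_closed[OF g]] add_neg[OF g] cmp_zero_left[OF f] Mor_objects[OF g]
    by simp
qed

lemma isomorphism_ident: "A \<in> Ob C \<Longrightarrow> is_isomorphism C A A (ident C A)"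
  unfolding is_isomorphism_def using ident_closed cmp_ident_left by blast

lemma isomorphism_neg_ident: "A \<in> Ob C \<Longrightarrow> is_isomorphism C A A (mneg C (ident C A))"
proof -
  assume "A \<in> Ob C"
  then have i: "ident C A \<in> Mor C A A" by (rule ident_closed)
  have "mneg C (ident C A) \<cdot> mneg C (ident C A) = ident C A"
    using cmp_neg_left[OF neg_closed[OF i] i] cmp_ident_left[OF neg_closed[OF i]] neg_neg[OF i] by simp
  then show ?thesis unfolding is_isomorphism_def using neg_closed[OF i] by blast
qed

lemma isomorphic_refl: "A \<in> Ob C \<Longrightarrow> isomorphic C A A"
  unfolding isomorphic_def using isomorphism_ident by blast

lemma isomorphic_sym: "isomorphic C A B \<Longrightarrow> isomorphic C B A"
  unfolding isomorphic_def is_isomorphism_def by blast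

lemma isomorphic_trans: "\<lbrakk>isomorphic C A B; isomorphic C B D\<rbrakk> \<Longrightarrow> isomorphic C A D"
  unfolding isomorphic_def is_isomorphism_def
proof (elim exE conjE bexE)
  fix f g f' g'
  assume f: "f \<in> Mor C A B" "g \<in> Mor C B A" "g \<cdot> f = ident C A" "f \<cdot> g = ident C B"
    and f': "f' \<in> Mor C B D" "g' \<in> Mor C D B" "g' \<cdot> f' = ident C B" "f' \<cdot> g' = ident C D"
  have "(g \<cdot> g') \<cdot> (f' \<cdot> f) = g \<cdot> (g' \<cdot> (f' \<cdot> f))"
    by (rule cmp_assoc[OF cmp_closed[OF f(1) f'(1)] f'(2) f(2)])
  also have "\<dots> = ident C A"
    using cmp_assoc[OF f(1) f'(1) f'(2)] f f' cmp_ident_left[OF f(1)] by simp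
  finally have 1: "(g \<cdot> g') \<cdot> (f' \<cdot> f) = ident C A" .
  have "(f' \<cdot> f) \<cdot> (g \<cdot> g') = f' \<cdot> (f \<cdot> (g \<cdot> g'))"
    by (rule cmp_assoc[OF cmp_closed[OF f'(2) f(2)] f(1) f'(1)])
  also have "\<dots> = ident C D"
    using cmp_assoc[OF f'(2) f(2) f(1)] f f' cmp_ident_left[OF f'(2)] by simp
  finally have 2: "(f' \<cdot> f) \<cdot> (g \<cdot> g') = ident C D" .
  show "\<exists>f. f \<in> Mor C A D \<and> (\<exists>g\<in>Mor C D A. g \<cdot> f = ident C A \<and> f \<cdot> g = ident C D)"
    using 1 2 cmp_closed[OF f(1) f'(1)] cmp_closed[OF f'(2) f(2)] by blast
qed

lemma isomorphic_objects: "isomorphic C A B \<Longrightarrow> A \<in> Ob C \<and> B \<in> Ob C"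
  unfolding isomorphic_def is_isomorphism_def using Mor_objects by blast

lemma iso_class_eq_iff:
  assumes "A \<in> S" "B \<in> S" "S \<subseteq> Ob C"
  shows "iso_class C S A = iso_class C S B \<longleftrightarrow> isomorphic C A B"
proof
  assume "iso_class C S A = iso_class C S B"
  then have "B \<in> iso_class C S A" using isomorphic_refl assms by (auto simp: iso_class_def)
  then show "isomorphic C A B" by (simp add: iso_class_def)
next
  assume "isomorphic C A B"
  then show "iso_class C S A = iso_class C S B"
    unfolding iso_class_def using isomorphic_sym isomorphic_trans by blast
qed

lemma zero_object_to: "\<lbrakk>is_zero_object C Z; f \<in> Mor C A Z\<rbrakk> \<Longrightarrow> f = mzero C A Z"
  using cmp_ident_left[of f A Z] cmp_zero_left[of f A Z Z] by (simp add: is_zero_object_def)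

text \<open>An isomorphism exhibits its target as the sum of its source and zero, so statements on
  biproducts cover isomorphisms as well.\<close>

lemma biproduct_zero_isomorphic:
  assumes Z: "is_zero_object C Z" and "isomorphic C A B"
  shows "is_biproduct C Z A B"
proof -
  obtain f g where f: "f \<in> Mor C A B" "g \<in> Mor C B A" "g \<cdot> f = ident C A" "f \<cdot> g = ident C B"
    using assms(2) unfolding isomorphic_def is_isomorphism_def by blast
  have ob: "Z \<in> Ob C" "A \<in> Ob C" "B \<in> Ob C"
    using Z Mor_objects[OF f(1)] by (auto simp: is_zero_object_def)
  have z: "mzero C Z B \<in> Mor C Z B" "mzero C B Z \<in> Mor C B Z" "mzero C B B \<in> Mor C B B"
    using ob zero_closed by auto
  have "mzero C B Z \<cdot> mzero C Z B = ident C Z"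
    using cmp_zero_left[OF z(1), of Z] Z by (simp add: is_zero_object_def)
  moreover have "g \<cdot> mzero C Z B = mzero C Z A" using cmp_zero_right[OF f(2)] ob by simp
  moreover have "mzero C B Z \<cdot> f = mzero C A Z" using cmp_zero_left[OF f(1)] ob by simp
  moreover have "madd C (mzero C Z B \<cdot> mzero C B Z) (f \<cdot> g) = ident C B"
    using cmp_zero_left[OF z(2), of B] f(4) zero_add[OF ident_closed] ob by simp
  ultimately show ?thesis unfolding is_biproduct_def using ob z f by blast
qed

lemma biproduct_commute: "is_biproduct C A B D \<Longrightarrow> is_biproduct C B A D"
proof -
  assume "is_biproduct C A B D"
  then obtain i j p q where ob: "A \<in> Ob C" "B \<in> Ob C" "D \<in> Ob C"
    and m: "i \<in> Mor C A D" "j \<in> Mor C B D" "p \<in> Mor C D A" "q \<in> Mor C D B"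
    and eq: "p \<cdot> i = ident C A" "q \<cdot> j = ident C B" "q \<cdot> i = mzero C A B" "p \<cdot> j = mzero C B A"
      "madd C (i \<cdot> p) (j \<cdot> q) = ident C D"
    unfolding is_biproduct_def by blast
  have "madd C (j \<cdot> q) (i \<cdot> p) = ident C D"
    using eq(5) add_commute[OF cmp_closed[OF m(3,1)] cmp_closed[OF m(4,2)]] by simp
  then show ?thesis unfolding is_biproduct_def using ob m eq by blast
qed

end

section \<open>Triangles\<close>

context triangulated_category
begin

definition "distinguished A B D f g h \<longleftrightarrow>
  f \<in> Mor C A B \<and> g \<in> Mor C B D \<and> h \<in> Mor C D (shO C A) \<and> (f, g, h) \<in> dtri C"

lemma triangleD:
  assumes "distinguished A B D f g h"
  shows "f \<in> Mor C A B" "g \<in> Mor C B D" "h \<in> Mor C D (shO C A)" "(f, g, h) \<in> dtri C"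
    "A \<in> Ob C" "B \<in> Ob C" "D \<in> Ob C"
  using assms Mor_objects unfolding distinguished_def by blast+

lemma shM_closed: "f \<in> Mor C A B \<Longrightarrow> shM C f \<in> Mor C (shO C A) (shO C B)"
  using shM_fully_faithful[of A B] Mor_objects[of f A B] by (auto simp: bij_betw_def)

lemma shM_full:
  assumes "x \<in> Mor C (shO C A) (shO C B)" "A \<in> Ob C" "B \<in> Ob C"
  obtains y where "y \<in> Mor C A B" "shM C y = x"
proof -
  have "x \<in> shM C ` Mor C A B"
    using shM_fully_faithful[OF assms(2,3)] assms(1) by (simp add: bij_betw_def)
  then show thesis using that by blast
qed

lemma shM_faithful: "\<lbrakk>f \<in> Mor C A B; g \<in> Mor C A B; shM C f = shM C g\<rbrakk> \<Longrightarrow> f = g"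
  using shM_fully_faithful[of A B] Mor_objects[of f A B] by (auto simp: bij_betw_def inj_on_def)

lemma shM_zero:
  assumes "A \<in> Ob C" "B \<in> Ob C"
  shows "shM C (mzero C A B) = mzero C (shO C A) (shO C B)"
proof -
  have z: "mzero C A B \<in> Mor C A B" using assms by (rule zero_closed)
  have "madd C (shM C (mzero C A B)) (shM C (mzero C A B)) = shM C (mzero C A B)"
    using shM_add[OF z z] zero_add[OF z] by simp
  then show ?thesis
    using add_left_cancel[OF shM_closed[OF z] shM_closed[OF z] zero_closed]
      add_zero[OF shM_closed[OF z]] assms shO_closed by auto
qed

lemma shift_zero_object: "is_zero_object C Z \<Longrightarrow> is_zero_object C (shO C Z)"
  by (metis is_zero_object_def shM_ident shM_zero shO_closed)

lemma triangle_rotate: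
  "distinguished A B D f g h \<Longrightarrow> distinguished B D (shO C A) g h (mneg C (shM C f))"
  unfolding distinguished_def using dtri_rotate neg_closed shM_closed by blast

lemma triangle_unrotate:
  "\<lbrakk>f \<in> Mor C A B; distinguished B D (shO C A) g h (mneg C (shM C f))\<rbrakk> \<Longrightarrow> distinguished A B D f g h"
  unfolding distinguished_def using dtri_rotate by blast

lemma triangle_iso:
  assumes "distinguished A B D f g h"
    and "f' \<in> Mor C A' B'" "g' \<in> Mor C B' D'" "h' \<in> Mor C D' (shO C A')"
    and "is_isomorphism C A A' a" "is_isomorphism C B B' b" "is_isomorphism C D D' d"
    and "b \<cdot> f = f' \<cdot> a" "d \<cdot> g = g' \<cdot> b" "shM C a \<cdot> h = h' \<cdot> d"
  shows "distinguished A' B' D' f' g' h'"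
  using dtri_iso[OF _ _ _ _ assms(2-10)] assms(1-4) unfolding distinguished_def by blast

text \<open>The square with the identity of \<open>A\<close> and \<open>f\<close> starts a morphism from the triangle
  \<open>A \<rightarrow> A \<rightarrow> 0\<close>, whose third component shows that \<open>g \<cdot> f\<close> factors through zero.\<close>

lemma triangle_gf:
  assumes t: "distinguished A B D f g h"
  shows "g \<cdot> f = mzero C A D"
proof -
  note T = triangleD[OF t]
  obtain Z where Z: "is_zero_object C Z" using zero_object_exists by blast
  have zob: "Z \<in> Ob C" using Z by (simp add: is_zero_object_def)
  have z: "mzero C A Z \<in> Mor C A Z" using T zob zero_closed by blast
  obtain d where d: "d \<in> Mor C Z D" "d \<cdot> mzero C A Z = g \<cdot> f"
    using dtri_morphism[OF dtri_ident[OF T(5) Z] T(4) ident_closed[OF T(5)] z T(1,2)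
        ident_closed[OF T(5)] T(1) refl] by blast
  show ?thesis using d(2) cmp_zero_right[OF d(1) T(5)] by simp
qed

lemma triangle_hg: "distinguished A B D f g h \<Longrightarrow> h \<cdot> g = mzero C B (shO C A)"
  using triangle_gf[OF triangle_rotate] .

text \<open>A morphism \<open>x\<close> with \<open>g \<cdot> x = 0\<close> and the zero morphism form a square from the rotation of
  \<open>Y \<rightarrow> Y \<rightarrow> 0\<close> to the rotation of the given triangle. The third component of a morphism of
  triangles is the suspension of the lift, because the suspension is
  fully faithful.\<close>

lemma triangle_exact_middle:
  assumes t: "distinguished A B D f g h" and x: "x \<in> Mor C Y B" and gx: "g \<cdot> x = mzero C Y D"
  obtains y where "y \<in> Mor C Y A" "f \<cdot> y = x"
proof -
  note T = triangleD[OF t]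
  obtain Z where Z: "is_zero_object C Z" using zero_object_exists by blast
  have ob: "Z \<in> Ob C" "Y \<in> Ob C" using Z Mor_objects[OF x] by (auto simp: is_zero_object_def)
  have "distinguished Y Y Z (ident C Y) (mzero C Y Z) (mzero C Z (shO C Y))"
    unfolding distinguished_def using ob Z dtri_ident ident_closed zero_closed shO_closed by auto
  note R = triangleD[OF triangle_rotate[OF this]] and S = triangleD[OF triangle_rotate[OF t]]
  have z: "mzero C Z D \<in> Mor C Z D" using ob T zero_closed by blast
  have "mzero C Z D \<cdot> mzero C Y Z = g \<cdot> x" using cmp_zero_right[OF z ob(2)] gx by simp
  from dtri_morphism[OF R(4) S(4) R(1,2) S(1,2) x z this]
  obtain d where d: "d \<in> Mor C (shO C Y) (shO C A)"
    and eq: "shM C x \<cdot> mneg C (shM C (ident C Y)) = mneg C (shM C f) \<cdot> d" by blast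
  obtain y where y: "y \<in> Mor C Y A" "shM C y = d" using shM_full[OF d ob(2) T(5)] .
  have sx: "shM C x \<in> Mor C (shO C Y) (shO C B)" using x by (rule shM_closed)
  have si: "shM C (ident C Y) = ident C (shO C Y)" "ident C (shO C Y) \<in> Mor C (shO C Y) (shO C Y)"
    using ob shM_ident ident_closed shO_closed by auto
  have "mneg C (shM C x) = mneg C (shM C f \<cdot> d)"
    using eq si cmp_neg_right[OF si(2) sx] cmp_ident_right[OF sx]
      cmp_neg_left[OF d shM_closed[OF T(1)]] by simp
  then have "shM C x = shM C f \<cdot> d"
    using neg_neg[OF sx] neg_neg[OF cmp_closed[OF d shM_closed[OF T(1)]]] by metis
  then have "shM C (f \<cdot> y) = shM C x" using shM_cmp[OF y(1) T(1)] y(2) by simp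
  then have "f \<cdot> y = x" using shM_faithful[OF cmp_closed[OF y(1) T(1)] x] by blast
  with y(1) that show thesis by blast
qed

lemma triangle_exact_right:
  assumes "distinguished A B D f g h" "x \<in> Mor C Y D" "h \<cdot> x = mzero C Y (shO C A)"
  obtains y where "y \<in> Mor C Y B" "g \<cdot> y = x"
  using triangle_exact_middle[OF triangle_rotate[OF assms(1)] assms(2,3)] .

lemma triangle_exact_shift:
  assumes t: "distinguished A B D f g h" and x: "x \<in> Mor C Y (shO C A)"
    and z: "shM C f \<cdot> x = mzero C Y (shO C B)"
  obtains y where "y \<in> Mor C Y D" "h \<cdot> y = x"
proof -
  note T = triangleD[OF t]
  have ob: "Y \<in> Ob C" "shO C B \<in> Ob C" using Mor_objects[OF x] T shO_closed by auto
  have "mneg C (shM C f) \<cdot> x = mzero C Y (shO C B)"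
    using cmp_neg_left[OF x shM_closed[OF T(1)]] z neg_zero[OF ob] by simp
  from triangle_exact_middle[OF triangle_rotate[OF triangle_rotate[OF t]] x this] that
  show thesis by blast
qed

text \<open>Three rotations negate all three shifted morphisms; two of the signs cancel by means of
  minus the identity on the middle object.\<close>

lemma triangle_shift_iff:
  assumes f: "f \<in> Mor C A B" and g: "g \<in> Mor C B D" and h: "h \<in> Mor C D (shO C A)"
  shows "distinguished A B D f g h \<longleftrightarrow>
    distinguished (shO C A) (shO C B) (shO C D) (shM C f) (shM C g) (mneg C (shM C h))"
proof -
  let ?A = "shO C A" and ?B = "shO C B" and ?D = "shO C D"
  let ?f = "shM C f" and ?g = "shM C g" and ?h = "mneg C (shM C h)"
  have s: "?f \<in> Mor C ?A ?B" "?g \<in> Mor C ?B ?D" "?h \<in> Mor C ?D (shO C ?A)"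
    using f g h shM_closed neg_closed by blast+
  have ob: "?A \<in> Ob C" "?B \<in> Ob C" "?D \<in> Ob C" using s Mor_objects by blast+
  have i: "ident C ?A \<in> Mor C ?A ?A" "ident C ?B \<in> Mor C ?B ?B" using ob ident_closed by auto
  have neg_f: "mneg C (ident C ?B) \<cdot> ?f = mneg C ?f"
    using cmp_neg_left[OF s(1) i(2)] cmp_ident_left[OF s(1)] by simp
  have neg_g: "?g \<cdot> mneg C (ident C ?B) = mneg C ?g"
    using cmp_neg_right[OF i(2) s(2)] cmp_ident_right[OF s(2)] by simp
  have third: "shM C (ident C ?A) \<cdot> ?h = ?h \<cdot> ident C ?D"
    using shM_ident[OF ob(1)] cmp_ident_left[OF s(3)] cmp_ident_right[OF s(3)] by simp
  have "distinguished A B D f g h \<longleftrightarrow> distinguished ?A ?B ?D (mneg C ?f) (mneg C ?g) ?h"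
    using triangle_rotate[of A B D f g h] triangle_unrotate[OF f, of D g h]
      triangle_rotate[of B D ?A g h "mneg C ?f"] triangle_unrotate[OF g, of ?A h "mneg C ?f"]
      triangle_rotate[of D ?A ?B h "mneg C ?f" "mneg C ?g"]
      triangle_unrotate[OF h, of ?B "mneg C ?f" "mneg C ?g"] by blast
  also have "\<dots> \<longleftrightarrow> distinguished ?A ?B ?D ?f ?g ?h"
  proof
    assume t: "distinguished ?A ?B ?D (mneg C ?f) (mneg C ?g) ?h"
    show "distinguished ?A ?B ?D ?f ?g ?h"
    proof (rule triangle_iso[OF t s isomorphism_ident[OF ob(1)] isomorphism_neg_ident[OF ob(2)]
          isomorphism_ident[OF ob(3)] _ _ third])
      show "mneg C (ident C ?B) \<cdot> mneg C ?f = ?f \<cdot> ident C ?A"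
        using cmp_neg_right[OF s(1) neg_closed[OF i(2)]] neg_f neg_neg[OF s(1)]
          cmp_ident_right[OF s(1)] by simp
      show "ident C ?D \<cdot> mneg C ?g = ?g \<cdot> mneg C (ident C ?B)"
        using cmp_ident_left[OF neg_closed[OF s(2)]] neg_g by simp
    qed
  next
    assume t: "distinguished ?A ?B ?D ?f ?g ?h"
    show "distinguished ?A ?B ?D (mneg C ?f) (mneg C ?g) ?h"
    proof (rule triangle_iso[OF t neg_closed[OF s(1)] neg_closed[OF s(2)] s(3)
          isomorphism_ident[OF ob(1)] isomorphism_neg_ident[OF ob(2)]
          isomorphism_ident[OF ob(3)] _ _ third])
      show "mneg C (ident C ?B) \<cdot> ?f = mneg C ?f \<cdot> ident C ?A"
        using neg_f cmp_ident_right[OF neg_closed[OF s(1)]] by simp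
      show "ident C ?D \<cdot> ?g = mneg C ?g \<cdot> mneg C (ident C ?B)"
        using cmp_neg_left[OF neg_closed[OF i(2)] s(2)] neg_g neg_neg[OF s(2)]
          cmp_ident_left[OF s(2)] by simp
    qed
  qed
  finally show ?thesis .
qed

lemma triangle_iterated_shift:
  assumes "distinguished A B D f g h"
  shows "\<exists>h'. distinguished (shiftO C i A) (shiftO C i B) (shiftO C i D) (shiftM C i f) (shiftM C i g) h'"
proof (induction i)
  case 0
  then show ?case using assms by auto
next
  case (Suc i)
  then obtain h' where
    t: "distinguished (shiftO C i A) (shiftO C i B) (shiftO C i D) (shiftM C i f) (shiftM C i g) h'" by blast
  show ?case using triangle_shift_iff[OF triangleD(1-3)[OF t]] t by auto
qed

lemma shiftO_closed: "A \<in> Ob C \<Longrightarrow> shiftO C i A \<in> Ob C"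
  by (induction i) (auto simp: shO_closed)

text \<open>A triangle with vanishing connecting morphism splits: exactness lifts the identity of \<open>D\<close> to a
  section \<open>s\<close>, and \<open>1 - s \<cdot> g\<close> factors through \<open>f\<close>, which is a monomorphism since
  whatever it kills comes from the connecting morphism.\<close>

lemma triangle_zero_imp_biproduct:
  assumes t: "distinguished A B D f g (mzero C D (shO C A))"
  shows "is_biproduct C A D B"
proof -
  note T = triangleD[OF t]
  have sA: "shO C A \<in> Ob C" using T shO_closed by blast
  have i: "ident C A \<in> Mor C A A" "ident C B \<in> Mor C B B" "ident C D \<in> Mor C D D"
    using T ident_closed by blast+
  obtain s where s: "s \<in> Mor C D B" "g \<cdot> s = ident C D"
    using triangle_exact_right[OF t i(3)] cmp_zero_left[OF i(3) sA] by blast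
  have sg: "s \<cdot> g \<in> Mor C B B" using T(2) s(1) by (rule cmp_closed)
  have gsg: "g \<cdot> (s \<cdot> g) = g" using cmp_assoc[OF T(2) s(1) T(2)] s(2) cmp_ident_left[OF T(2)] by simp
  let ?e = "madd C (ident C B) (mneg C (s \<cdot> g))"
  have e: "?e \<in> Mor C B B" using i(2) neg_closed[OF sg] add_closed by blast
  have "g \<cdot> ?e = mzero C B D"
    using cmp_add_right[OF i(2) neg_closed[OF sg] T(2)] cmp_neg_right[OF sg T(2)] gsg
      cmp_ident_right[OF T(2)] add_neg[OF T(2)] by simp
  from triangle_exact_middle[OF t e this]
  obtain r where r: "r \<in> Mor C B A" "f \<cdot> r = ?e" .
  have sum: "madd C (f \<cdot> r) (s \<cdot> g) = ident C B"
    using r(2) add_assoc[OF i(2) neg_closed[OF sg] sg] neg_add[OF sg] add_zero[OF i(2)] by simp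
  have mono: "x = mzero C Y A" if x: "x \<in> Mor C Y A" and fx: "f \<cdot> x = mzero C Y B" for Y x
  proof -
    have Y: "Y \<in> Ob C" using Mor_objects[OF x] by simp
    have "shM C f \<cdot> shM C x = mzero C (shO C Y) (shO C B)"
      using shM_cmp[OF x T(1)] fx shM_zero[OF Y T(6)] by simp
    from triangle_exact_shift[OF t shM_closed[OF x] this]
    obtain y where y: "y \<in> Mor C (shO C Y) D" "mzero C D (shO C A) \<cdot> y = shM C x" .
    have "shM C x = shM C (mzero C Y A)"
      using cmp_zero_left[OF y(1) sA] y(2) shM_zero[OF Y T(5)] by simp
    then show ?thesis using shM_faithful[OF x zero_closed[OF Y T(5)]] by blast
  qed
  have gf: "g \<cdot> f = mzero C A D" using t by (rule triangle_gf)
  have sgf: "s \<cdot> (g \<cdot> f) = mzero C A B" using gf cmp_zero_right[OF s(1) T(5)] by simp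
  have rf: "r \<cdot> f \<in> Mor C A A" using T(1) r(1) by (rule cmp_closed)
  have frf: "f \<cdot> (r \<cdot> f) = f"
  proof -
    have "f \<cdot> (r \<cdot> f) = ?e \<cdot> f" using cmp_assoc[OF T(1) r(1) T(1)] r(2) by simp
    also have "\<dots> = madd C f (mneg C (s \<cdot> g \<cdot> f))"
      using cmp_add_left[OF T(1) i(2) neg_closed[OF sg]] cmp_ident_left[OF T(1)]
        cmp_neg_left[OF T(1) sg] by simp
    also have "s \<cdot> g \<cdot> f = mzero C A B" using cmp_assoc[OF T(1) T(2) s(1)] sgf by simp
    finally show ?thesis using neg_zero[OF T(5,6)] add_zero[OF T(1)] by simp
  qed
  have "r \<cdot> f = ident C A"
  proof (rule diff_zero_imp_eq[OF rf i(1)], rule mono)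
    show "madd C (r \<cdot> f) (mneg C (ident C A)) \<in> Mor C A A"
      using rf neg_closed[OF i(1)] add_closed by blast
    show "f \<cdot> madd C (r \<cdot> f) (mneg C (ident C A)) = mzero C A B"
      using cmp_add_right[OF rf neg_closed[OF i(1)] T(1)] frf cmp_neg_right[OF i(1) T(1)]
        cmp_ident_right[OF T(1)] add_neg[OF T(1)] by simp
  qed
  moreover have "r \<cdot> s = mzero C D A"
  proof (rule mono)
    show "r \<cdot> s \<in> Mor C D A" using s(1) r(1) by (rule cmp_closed)
    have "f \<cdot> (r \<cdot> s) = ?e \<cdot> s" using cmp_assoc[OF s(1) r(1) T(1)] r(2) by simp
    also have "\<dots> = madd C s (mneg C (s \<cdot> g \<cdot> s))"
      using cmp_add_left[OF s(1) i(2) neg_closed[OF sg]] cmp_ident_left[OF s(1)]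
        cmp_neg_left[OF s(1) sg] by simp
    also have "s \<cdot> g \<cdot> s = s" using cmp_assoc[OF s(1) T(2) s(1)] s(2) cmp_ident_right[OF s(1)] by simp
    finally show "f \<cdot> (r \<cdot> s) = mzero C D B" using add_neg[OF s(1)] by simp
  qed
  ultimately show ?thesis unfolding is_biproduct_def using T s r gf sum by blast
qed

text \<open>The inclusion \<open>i\<close> has a cone \<open>B'\<close>; as \<open>i\<close> is split, the connecting morphism is zero. Both
  \<open>B\<close> and \<open>B'\<close> are then cokernels of \<open>i\<close>, so they are isomorphic.\<close>

lemma biproduct_imp_triangle:
  assumes "is_biproduct C A B D"
  obtains f g where "distinguished A D B f g (mzero C B (shO C A))"
proof -
  obtain i j p q where ob: "A \<in> Ob C" "B \<in> Ob C" "D \<in> Ob C"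
    and m: "i \<in> Mor C A D" "j \<in> Mor C B D" "p \<in> Mor C D A" "q \<in> Mor C D B"
    and eq: "p \<cdot> i = ident C A" "q \<cdot> j = ident C B" "q \<cdot> i = mzero C A B" "p \<cdot> j = mzero C B A"
      "madd C (i \<cdot> p) (j \<cdot> q) = ident C D"
    using assms unfolding is_biproduct_def by blast
  have sob: "shO C A \<in> Ob C" using ob shO_closed by blast
  obtain g h where "(i, g, h) \<in> dtri C" using dtri_cone[OF m(1)] by blast
  then obtain B' where t: "distinguished A D B' i g h"
    using dtri_typed[of i g h] Mor_unique[OF m(1)] unfolding distinguished_def by blast
  note T = triangleD[OF t]
  have h0: "h = mzero C B' (shO C A)"
  proof -
    have "shM C i \<cdot> h = mzero C B' (shO C D)"
      using triangle_hg[OF triangle_rotate[OF t]] cmp_neg_left[OF T(3) shM_closed[OF m(1)]]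
        neg_neg[OF cmp_closed[OF T(3) shM_closed[OF m(1)]]] neg_zero ob T shO_closed by metis
    then have "shM C p \<cdot> (shM C i \<cdot> h) = mzero C B' (shO C A)"
      using cmp_zero_right[OF shM_closed[OF m(3)]] T by simp
    moreover have "shM C p \<cdot> (shM C i \<cdot> h) = h"
      using cmp_assoc[OF T(3) shM_closed[OF m(1)] shM_closed[OF m(3)]] shM_cmp[OF m(1,3)] eq(1)
        shM_ident[OF ob(1)] cmp_ident_left[OF T(3)] by simp
    ultimately show ?thesis by simp
  qed
  obtain s where s: "s \<in> Mor C B' D" "g \<cdot> s = ident C B'"
    using triangle_exact_right[OF t ident_closed[OF T(7)]] h0 cmp_zero_left[OF ident_closed[OF T(7)] sob]
    by blast
  have gi: "g \<cdot> i = mzero C A B'" using t by (rule triangle_gf)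
  \<comment> \<open>Modulo the summand \<open>A\<close> every morphism factors through the other summand.\<close>
  have factor: "x \<cdot> (j \<cdot> q) = x" if x: "x \<in> Mor C D E" and xi: "x \<cdot> i = mzero C A E" for x E
  proof -
    have E: "E \<in> Ob C" using Mor_objects[OF x] by simp
    have "x = x \<cdot> madd C (i \<cdot> p) (j \<cdot> q)" using eq(5) cmp_ident_right[OF x] by simp
    also have "\<dots> = madd C (x \<cdot> (i \<cdot> p)) (x \<cdot> (j \<cdot> q))"
      by (rule cmp_add_right[OF cmp_closed[OF m(3,1)] cmp_closed[OF m(4,2)] x])
    also have "x \<cdot> (i \<cdot> p) = mzero C D E"
      using cmp_assoc[OF m(3,1) x] xi cmp_zero_left[OF m(3) E] by simp
    finally show ?thesis using zero_add[OF cmp_closed[OF cmp_closed[OF m(4,2)] x]] by simp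
  qed
  have gj: "g \<cdot> j \<in> Mor C B B'" and qs: "q \<cdot> s \<in> Mor C B' B"
    using cmp_closed[OF m(2) T(2)] cmp_closed[OF s(1) m(4)] by auto
  have gjq: "g \<cdot> j \<cdot> q = g" using factor[OF T(2) gi] cmp_assoc[OF m(4,2) T(2)] by simp
  have 1: "g \<cdot> j \<cdot> (q \<cdot> s) = ident C B'"
    using cmp_assoc[OF s(1) m(4) gj] gjq s(2) by simp
  \<comment> \<open>\<open>1 - s \<cdot> g\<close> is killed by \<open>g\<close>, hence factors through \<open>i\<close>, which \<open>q\<close> kills.\<close>
  have sgq: "q \<cdot> (s \<cdot> g) = q"
  proof -
    have c: "s \<cdot> g \<in> Mor C D D" using cmp_closed[OF T(2) s(1)] .
    let ?y = "madd C (ident C D) (mneg C (s \<cdot> g))"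
    have y: "?y \<in> Mor C D D" using ident_closed[OF ob(3)] neg_closed[OF c] add_closed by blast
    have "g \<cdot> (s \<cdot> g) = g" using cmp_assoc[OF T(2) s(1) T(2)] s(2) cmp_ident_left[OF T(2)] by simp
    then have "g \<cdot> ?y = mzero C D B'"
      using cmp_add_right[OF ident_closed[OF ob(3)] neg_closed[OF c] T(2)] cmp_neg_right[OF c T(2)]
        cmp_ident_right[OF T(2)] add_neg[OF T(2)] by simp
    from triangle_exact_middle[OF t y this] obtain z where z: "z \<in> Mor C D A" "i \<cdot> z = ?y" .
    have "q \<cdot> ?y = mzero C D B"
      using cmp_assoc[OF z(1) m(1,4)] z(2) eq(3) cmp_zero_left[OF z(1) ob(2)] by simp
    then have "madd C q (mneg C (q \<cdot> (s \<cdot> g))) = mzero C D B"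
      using cmp_add_right[OF ident_closed[OF ob(3)] neg_closed[OF c] m(4)] cmp_neg_right[OF c m(4)]
        cmp_ident_right[OF m(4)] by simp
    then show ?thesis using diff_zero_imp_eq[OF m(4) cmp_closed[OF c m(4)]] by simp
  qed
  have 2: "q \<cdot> s \<cdot> (g \<cdot> j) = ident C B"
    using cmp_assoc[OF m(2) T(2) qs] cmp_assoc[OF T(2) s(1) m(4)] sgq eq(2) by simp
  have "is_isomorphism C B' B (q \<cdot> s)" unfolding is_isomorphism_def using 1 2 gj qs by blast
  moreover have "q \<cdot> s \<cdot> g = q" using cmp_assoc[OF T(2) s(1) m(4)] sgq by simp
  ultimately have "distinguished A D B i q (mzero C B (shO C A))"
    using triangle_iso[OF t m(1) m(4) zero_closed[OF ob(2) sob] isomorphism_ident[OF ob(1)]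
        isomorphism_ident[OF ob(3)], of "q \<cdot> s"]
      cmp_ident_left[OF m(1)] cmp_ident_right[OF m(1)] cmp_ident_right[OF m(4)] h0
      cmp_zero_left[OF qs sob] cmp_zero_right[OF shM_closed[OF ident_closed[OF ob(1)]] T(7)] by simp
  then show thesis by (rule that)
qed

text \<open>Two triangles that end in the same object \<open>D\<close> have a homotopy pullback \<open>E\<close> of \<open>B \<rightarrow> D \<leftarrow> Y\<close>, and
  the connecting morphisms of the two new triangles are the restrictions of the given ones. The
  suspension of \<open>E\<close> is the cone of the composite of \<open>g'\<close> and \<open>h\<close>, and the octahedral axiom for this
  composite yields the suspensions of the two triangles, up to rotation.\<close>

lemma triangle_pullback:
  assumes t: "distinguished A B D f g h" and t1: "distinguished D' Y D f' g' h'"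
  obtains E f2 g2 f3 g3
  where "distinguished D' E B f2 g2 (h' \<cdot> g)" "distinguished A E Y f3 g3 (h \<cdot> g')"
proof -
  note T = triangleD[OF t] and T1 = triangleD[OF t1]
  have c: "h \<cdot> g' \<in> Mor C Y (shO C A)" using T1(2) T(3) by (rule cmp_closed)
  have c': "h' \<cdot> g \<in> Mor C B (shO C D')" using T(2) T1(3) by (rule cmp_closed)
  obtain k k' where "(h \<cdot> g', k, k') \<in> dtri C" using dtri_cone[OF c] by blast
  then obtain Q where tQ: "distinguished Y (shO C A) Q (h \<cdot> g') k k'"
    using dtri_typed[of "h \<cdot> g'" k k'] Mor_unique[OF c] unfolding distinguished_def by blast
  note R = triangleD[OF triangle_rotate[OF t1]]
    and S = triangleD[OF triangle_rotate[OF triangle_rotate[OF t]]] and K = triangleD[OF tQ]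
  obtain u v where uv: "u \<in> Mor C (shO C D') Q" "v \<in> Mor C Q (shO C B)"
      "(u, v, shM C h' \<cdot> mneg C (shM C g)) \<in> dtri C"
    using octahedral[OF T1(2) T(3) R(4) S(4) K(4) R(2) K(2) S(2)] by blast
  \<comment> \<open>The suspension is invertible on objects only up to isomorphism.\<close>
  obtain E e' where E: "E \<in> Ob C" and e': "is_isomorphism C (shO C E) Q e'"
    using shO_ess_surj[OF K(7)] unfolding isomorphic_def by blast
  obtain e where em: "e \<in> Mor C Q (shO C E)" "e' \<in> Mor C (shO C E) Q"
      "e \<cdot> e' = ident C (shO C E)" "e' \<cdot> e = ident C Q"
    using e' unfolding is_isomorphism_def by blast
  then have e: "is_isomorphism C Q (shO C E) e" unfolding is_isomorphism_def by blast
  have third: "shM C h' \<cdot> mneg C (shM C g) = mneg C (shM C (h' \<cdot> g))"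
    using cmp_neg_right[OF shM_closed[OF T(2)] shM_closed[OF T1(3)]] shM_cmp[OF T(2) T1(3)] by simp
  have sc': "mneg C (shM C (h' \<cdot> g)) \<in> Mor C (shO C B) (shO C (shO C D'))"
    using neg_closed[OF shM_closed[OF c']] .
  have sob: "shO C D' \<in> Ob C" "shO C A \<in> Ob C" "shO C B \<in> Ob C" using T T1 shO_closed by auto
  obtain f2 where f2: "f2 \<in> Mor C D' E" "shM C f2 = e \<cdot> u"
    using shM_full[OF cmp_closed[OF uv(1) em(1)] T1(5) E] .
  obtain g2 where g2: "g2 \<in> Mor C E B" "shM C g2 = v \<cdot> e'"
    using shM_full[OF cmp_closed[OF em(2) uv(2)] E T(6)] .
  have tuv: "distinguished (shO C D') Q (shO C B) u v (mneg C (shM C (h' \<cdot> g)))"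
    unfolding distinguished_def using uv third sc' by simp
  have "distinguished (shO C D') (shO C E) (shO C B) (shM C f2) (shM C g2) (mneg C (shM C (h' \<cdot> g)))"
  proof (rule triangle_iso[OF tuv shM_closed[OF f2(1)] shM_closed[OF g2(1)] sc'
        isomorphism_ident[OF sob(1)] e isomorphism_ident[OF sob(3)]])
    show "e \<cdot> u = shM C f2 \<cdot> ident C (shO C D')"
      using f2(2) cmp_ident_right[OF cmp_closed[OF uv(1) em(1)]] by simp
    show "ident C (shO C B) \<cdot> v = shM C g2 \<cdot> e"
      using g2(2) cmp_assoc[OF em(1,2) uv(2)] em(4) cmp_ident_left[OF uv(2)] cmp_ident_right[OF uv(2)]
      by simp
    show "shM C (ident C (shO C D')) \<cdot> mneg C (shM C (h' \<cdot> g))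
        = mneg C (shM C (h' \<cdot> g)) \<cdot> ident C (shO C B)"
      using shM_ident[OF sob(1)] cmp_ident_left[OF sc'] cmp_ident_right[OF sc'] by simp
  qed
  then have 1: "distinguished D' E B f2 g2 (h' \<cdot> g)"
    using triangle_shift_iff[OF f2(1) g2(1) c'] by simp
  have ek: "e \<cdot> k \<in> Mor C (shO C A) (shO C E)" "k' \<cdot> e' \<in> Mor C (shO C E) (shO C Y)"
    using K em cmp_closed by blast+
  obtain f3 where f3: "f3 \<in> Mor C A E" "shM C f3 = mneg C (e \<cdot> k)"
    using shM_full[OF neg_closed[OF ek(1)] T(5) E] .
  obtain g3 where g3: "g3 \<in> Mor C E Y" "shM C g3 = mneg C (k' \<cdot> e')"
    using shM_full[OF neg_closed[OF ek(2)] E T1(6)] .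
  have "distinguished Y (shO C A) (shO C E) (h \<cdot> g') (e \<cdot> k) (k' \<cdot> e')"
  proof (rule triangle_iso[OF tQ c ek isomorphism_ident[OF T1(6)] isomorphism_ident[OF sob(2)] e])
    show "ident C (shO C A) \<cdot> (h \<cdot> g') = h \<cdot> g' \<cdot> ident C Y"
      using cmp_ident_left[OF c] cmp_ident_right[OF c] by simp
    show "e \<cdot> k = e \<cdot> k \<cdot> ident C (shO C A)" using cmp_ident_right[OF ek(1)] by simp
    show "shM C (ident C Y) \<cdot> k' = k' \<cdot> e' \<cdot> e"
      using shM_ident[OF T1(6)] cmp_ident_left[OF K(3)] cmp_assoc[OF em(1,2) K(3)] em(4)
        cmp_ident_right[OF K(3)] by simp
  qed
  then have "distinguished Y (shO C A) (shO C E) (h \<cdot> g') (mneg C (shM C f3)) (mneg C (shM C g3))"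
    using f3 g3 neg_neg[OF ek(1)] neg_neg[OF ek(2)] by simp
  then have 2: "distinguished A E Y f3 g3 (h \<cdot> g')"
    using triangle_unrotate f3(1) g3(1) by blast
  from 1 2 show thesis by (rule that)
qed

text \<open>Rotation to the left, with \<open>Z\<close> in the role of $D[-1]$. It exists up to isomorphism since the suspension
  is essentially surjective.\<close>

lemma triangle_rotate_back:
  assumes t: "distinguished A B D f g h"
  obtains Z w k where "distinguished Z A B w f k" "isomorphic C D (shO C Z)"
proof -
  note T = triangleD[OF t]
  obtain Z e' where Z: "Z \<in> Ob C" and e': "is_isomorphism C (shO C Z) D e'"
    using shO_ess_surj[OF T(7)] unfolding isomorphic_def by blast
  obtain e where em: "e \<in> Mor C D (shO C Z)" "e' \<in> Mor C (shO C Z) D"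
      "e \<cdot> e' = ident C (shO C Z)" "e' \<cdot> e = ident C D"
    using e' unfolding is_isomorphism_def by blast
  then have e: "is_isomorphism C D (shO C Z) e" unfolding is_isomorphism_def by blast
  have c: "e \<cdot> g \<in> Mor C B (shO C Z)" "h \<cdot> e' \<in> Mor C (shO C Z) (shO C A)"
    using cmp_closed[OF T(2) em(1)] cmp_closed[OF em(2) T(3)] .
  obtain w where w: "w \<in> Mor C Z A" "shM C w = mneg C (h \<cdot> e')"
    using shM_full[OF neg_closed[OF c(2)] Z T(5)] .
  have "distinguished A B (shO C Z) f (e \<cdot> g) (h \<cdot> e')"
  proof (rule triangle_iso[OF t T(1) c isomorphism_ident[OF T(5)] isomorphism_ident[OF T(6)] e])
    show "ident C B \<cdot> f = f \<cdot> ident C A" using cmp_ident_left[OF T(1)] cmp_ident_right[OF T(1)] by simp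
    show "e \<cdot> g = e \<cdot> g \<cdot> ident C B" using cmp_ident_right[OF c(1)] by simp
    show "shM C (ident C A) \<cdot> h = h \<cdot> e' \<cdot> e"
      using shM_ident[OF T(5)] cmp_ident_left[OF T(3)] cmp_assoc[OF em(1,2) T(3)] em(4)
        cmp_ident_right[OF T(3)] by simp
  qed
  then have "distinguished Z A B w f (e \<cdot> g)"
    using triangle_unrotate[OF w(1)] w(2) neg_neg[OF c(2)] by simp
  moreover have "isomorphic C D (shO C Z)" using e unfolding isomorphic_def by blast
  ultimately show thesis by (rule that)
qed

end

section \<open>Conflations and resolutions\<close>

locale cluster_tilting_subcategory = triangulated_category C
  for C :: "('o, 'm, 'z) tricat_scheme" (structure) +
  fixes n :: nat and X :: "'o set"
  assumes two_le_n: "2 \<le> n" and cluster_tilting: "cluster_tilting C n X"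
begin

lemma X_objects: "X \<subseteq> Ob C"
  using cluster_tilting unfolding cluster_tilting_def by blast

lemma X_object: "Y \<in> X \<Longrightarrow> Y \<in> Ob C"
  using X_objects by blast

text \<open>The degree up to which \<open>A\<close> looks like an object of \<open>X\<close>. It rises by one with each syzygy.\<close>

definition "vanishes k A \<longleftrightarrow>
  (\<forall>Y \<in> X. \<forall>i \<in> {1..k}. \<forall>x \<in> Mor C Y (shiftO C i A). x = mzero C Y (shiftO C i A))"

lemma X_iff_vanishes: "A \<in> X \<longleftrightarrow> A \<in> Ob C \<and> vanishes (n - 1) A"
proof -
  have "A \<in> X \<longleftrightarrow> A \<in> Ob C \<and> (\<forall>Y \<in> X. \<forall>i \<in> {1..n - 1}.
      Mor C Y (shiftO C i A) = {mzero C Y (shiftO C i A)})"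
    using cluster_tilting unfolding cluster_tilting_def by blast
  moreover have "Mor C Y (shiftO C i A) = {mzero C Y (shiftO C i A)} \<longleftrightarrow>
      (\<forall>x \<in> Mor C Y (shiftO C i A). x = mzero C Y (shiftO C i A))"
    if "A \<in> Ob C" "Y \<in> X" for Y i
    using zero_closed[of Y "shiftO C i A"] that X_object shiftO_closed by blast
  ultimately show ?thesis unfolding vanishes_def by blast
qed

lemma vanishesD:
  "\<lbrakk>vanishes k A; Y \<in> X; 1 \<le> i; i \<le> k; x \<in> Mor C Y (shiftO C i A)\<rbrakk> \<Longrightarrow> x = mzero C Y (shiftO C i A)"
  unfolding vanishes_def by auto

lemma zero_object_in_X:
  assumes "is_zero_object C Z"
  shows "Z \<in> X"
proof -
  have "is_zero_object C (shiftO C i Z)" for i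
    by (induction i) (auto simp: assms shift_zero_object)
  then show ?thesis
    using zero_object_to assms unfolding X_iff_vanishes vanishes_def is_zero_object_def by blast
qed

lemma biproduct_in_X:
  assumes AB: "A \<in> X" "B \<in> X" and D: "is_biproduct C A B D"
  shows "D \<in> X"
proof -
  obtain f g where "distinguished A D B f g (mzero C B (shO C A))"
    using biproduct_imp_triangle[OF D] .
  note t = triangle_iterated_shift[OF this]
  have Dob: "D \<in> Ob C" using D unfolding is_biproduct_def by blast
  have "x = mzero C Y (shiftO C i D)"
    if Y: "Y \<in> X" and i: "i \<in> {1..n - 1}" and x: "x \<in> Mor C Y (shiftO C i D)" for Y i x
  proof -
    obtain h where
      h: "distinguished (shiftO C i A) (shiftO C i D) (shiftO C i B) (shiftM C i f) (shiftM C i g) h"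
      using t by blast
    note T = triangleD[OF h]
    have "shiftM C i g \<cdot> x = mzero C Y (shiftO C i B)"
      using vanishesD[of "n - 1" B Y i] cmp_closed[OF x T(2)] AB(2) Y i X_iff_vanishes by simp
    from triangle_exact_middle[OF h x this]
    obtain y where y: "y \<in> Mor C Y (shiftO C i A)" "shiftM C i f \<cdot> y = x" .
    have "y = mzero C Y (shiftO C i A)"
      using vanishesD[of "n - 1" A Y i] y(1) AB(1) Y i X_iff_vanishes by simp
    then show ?thesis using y(2) cmp_zero_right[OF T(1) X_object[OF Y]] by simp
  qed
  then show ?thesis using Dob unfolding X_iff_vanishes[of D] vanishes_def by blast
qed

lemma isomorphic_in_X: "\<lbrakk>A \<in> X; isomorphic C A B\<rbrakk> \<Longrightarrow> B \<in> X"
  using zero_object_exists zero_object_in_X biproduct_zero_isomorphic biproduct_in_X by blast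

definition "conflation A B D \<longleftrightarrow> (\<exists>f g. conflation_R C X A B D f g)"

lemma conflation_iff: "conflation A B D \<longleftrightarrow> (\<exists>f g. \<exists>h \<in> E_R C X D A. distinguished A B D f g h)"
  unfolding conflation_def conflation_R_def distinguished_def E_R_def by blast

lemma conflation_Ob: "conflation A B D \<Longrightarrow> A \<in> Ob C \<and> B \<in> Ob C \<and> D \<in> Ob C"
  unfolding conflation_iff using triangleD(5-7) by blast

lemma biproduct_conflation:
  assumes "is_biproduct C A B D"
  shows "conflation A D B"
proof -
  obtain f g where t: "distinguished A D B f g (mzero C B (shO C A))"
    using biproduct_imp_triangle[OF assms] .
  have "mzero C B (shO C A) \<in> E_R C X B A"
    unfolding E_R_def using triangleD[OF t] cmp_zero_left shO_closed by blast
  with t show ?thesis unfolding conflation_iff by blast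
qed

lemma E_R_from_X: "\<lbrakk>h \<in> E_R C X D A; x \<in> Mor C Y D; Y \<in> X\<rbrakk> \<Longrightarrow> h \<cdot> x = mzero C Y (shO C A)"
  unfolding E_R_def by blast

lemma conflation_onto_X_splits:
  assumes "conflation A B D" "D \<in> X"
  shows "is_biproduct C A D B"
proof -
  obtain f g h where h: "h \<in> E_R C X D A" and t: "distinguished A B D f g h"
    using assms(1) unfolding conflation_iff by blast
  have "h = mzero C D (shO C A)"
    using E_R_from_X[OF h ident_closed] cmp_ident_right triangleD[OF t] assms(2) by metis
  with t show ?thesis using triangle_zero_imp_biproduct by blast
qed

text \<open>The connecting morphism of \<open>D' \<rightarrow> E \<rightarrow> B\<close> is that of the conflation precomposed with \<open>B \<rightarrow> D\<close>, so it
  kills morphisms from \<open>X\<close> as well. This keeps the new triangle a conflation even if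
  \<open>A \<rightarrow> B \<rightarrow> D\<close> is not one.\<close>

lemma triangle_conflation_pullback:
  assumes t: "distinguished A B D f g h" and c: "conflation D' Y D"
  obtains E f' g' y where "conflation D' E B" "y \<in> Mor C Y D" "distinguished A E Y f' g' (h \<cdot> y)"
proof -
  obtain u v w where w: "w \<in> E_R C X D D'" and s: "distinguished D' Y D u v w"
    using c unfolding conflation_iff by blast
  obtain E f2 g2 f3 g3 where E: "distinguished D' E B f2 g2 (w \<cdot> g)" "distinguished A E Y f3 g3 (h \<cdot> v)"
    using triangle_pullback[OF t s] .
  have "w \<cdot> g \<cdot> x = mzero C V (shO C D')" if "V \<in> X" "x \<in> Mor C V B" for V x
    using cmp_assoc[OF that(2) triangleD(2)[OF t] triangleD(3)[OF s]]
      E_R_from_X[OF w cmp_closed[OF that(2) triangleD(2)[OF t]] that(1)] by simp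
  then have "w \<cdot> g \<in> E_R C X B D'" unfolding E_R_def using triangleD(3)[OF E(1)] by blast
  with E triangleD(2)[OF s] show thesis using that unfolding conflation_iff by blast
qed

text \<open>Objects of \<open>X\<close> are projective for the conflations: pulled back along \<open>Y \<rightarrow> D\<close> with \<open>Y\<close> in \<open>X\<close>, a
  conflation splits.\<close>

lemma conflation_pullback:
  assumes c: "conflation A B D" and c': "conflation D' Y D" and Y: "Y \<in> X"
  obtains E where "conflation D' E B" "is_biproduct C A Y E"
proof -
  obtain f g h where h: "h \<in> E_R C X D A" and t: "distinguished A B D f g h"
    using c unfolding conflation_iff by blast
  obtain E f' g' y where E: "conflation D' E B" "y \<in> Mor C Y D" "distinguished A E Y f' g' (h \<cdot> y)"
    using triangle_conflation_pullback[OF t c'] .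
  then have "is_biproduct C A Y E"
    using E_R_from_X[OF h E(2) Y] triangle_zero_imp_biproduct by simp
  with E(1) show thesis by (rule that)
qed

text \<open>The cocone of a right approximation: the connecting morphism kills every morphism from \<open>X\<close>, since
  such a morphism factors through the approximation.\<close>

lemma approximation_conflation:
  assumes "A \<in> Ob C"
  obtains A' Y where "Y \<in> X" "conflation A' Y A"
proof -
  have "functorially_finite C X" using cluster_tilting by (simp add: cluster_tilting_def)
  then have "\<exists>Y \<in> X. \<exists>g \<in> Mor C Y A. \<forall>Y' \<in> X. \<forall>x \<in> Mor C Y' A. \<exists>y \<in> Mor C Y' Y. x = g \<cdot> y"
    using assms unfolding functorially_finite_def by simp
  then obtain Y g where Y: "Y \<in> X" and g: "g \<in> Mor C Y A"
    and approx: "\<And>Y' x. \<lbrakk>Y' \<in> X; x \<in> Mor C Y' A\<rbrakk> \<Longrightarrow> \<exists>y \<in> Mor C Y' Y. x = g \<cdot> y" by blast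
  obtain k k' where "(g, k, k') \<in> dtri C" using dtri_cone[OF g] by blast
  then obtain Q where "distinguished Y A Q g k k'"
    using dtri_typed[of g k k'] Mor_unique[OF g] unfolding distinguished_def by blast
  from triangle_rotate_back[OF this]
  obtain A' w h where t: "distinguished A' Y A w g h" .
  note T = triangleD[OF t]
  have "h \<cdot> x = mzero C Y' (shO C A')" if Y': "Y' \<in> X" and x: "x \<in> Mor C Y' A" for Y' x
  proof -
    obtain y where y: "y \<in> Mor C Y' Y" "x = g \<cdot> y" using approx[OF Y' x] by blast
    show ?thesis
      using y(2) cmp_assoc[OF y(1) T(2,3)] triangle_hg[OF t] cmp_zero_left[OF y(1) shO_closed[OF T(5)]]
      by simp
  qed
  then have "h \<in> E_R C X A A'" unfolding E_R_def using T by blast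
  with t Y show thesis using that unfolding conflation_iff by blast
qed

text \<open>Dimension shifting. A morphism to a suspension of the syzygy becomes zero in the suspension of \<open>Y\<close>,
  so it comes from the connecting morphism.\<close>

lemma syzygy_vanishes:
  assumes c: "conflation A' Y A" and Y: "Y \<in> X" and A: "vanishes k A" and k: "Suc k \<le> n - 1"
  shows "vanishes (Suc k) A'"
  unfolding vanishes_def
proof (intro ballI)
  fix V i x
  assume V: "V \<in> X" and "i \<in> {1..Suc k}" and x: "x \<in> Mor C V (shiftO C i A')"
  then obtain j where j: "i = Suc j" "j \<le> k" by (cases i) auto
  obtain f g h where h: "h \<in> E_R C X A A'" and t: "distinguished A' Y A f g h"
    using c unfolding conflation_iff by blast
  obtain h' where
    t': "distinguished (shiftO C j A') (shiftO C j Y) (shiftO C j A) (shiftM C j f) (shiftM C j g) h'"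
    and h': "j = 0 \<Longrightarrow> h' = h"
    using triangle_iterated_shift[OF t, of j] t by (cases "j = 0") auto
  note T = triangleD[OF t']
  have x': "x \<in> Mor C V (shO C (shiftO C j A'))" using x j by simp
  have Vob: "V \<in> Ob C" using V by (rule X_object)
  have "shM C (shiftM C j f) \<cdot> x \<in> Mor C V (shiftO C i Y)"
    using cmp_closed[OF x' shM_closed[OF T(1)]] j by simp
  then have "shM C (shiftM C j f) \<cdot> x = mzero C V (shO C (shiftO C j Y))"
    using vanishesD[of "n - 1" Y V i] Y V j k by (simp add: X_iff_vanishes)
  from triangle_exact_shift[OF t' x' this]
  obtain y where y: "y \<in> Mor C V (shiftO C j A)" "h' \<cdot> y = x" .
  \<comment> \<open>In degree zero the connecting morphism kills \<open>y\<close>, in higher degrees \<open>y\<close> itself vanishes.\<close>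
  have "h' \<cdot> y = mzero C V (shO C (shiftO C j A'))"
  proof (cases "j = 0")
    case True
    then show ?thesis using E_R_from_X[OF h _ V, of y] y(1) h' by simp
  next
    case False
    then have "y = mzero C V (shiftO C j A)" using vanishesD[OF A V _ _ y(1)] j by simp
    then show ?thesis using cmp_zero_right[OF T(3) Vob] by simp
  qed
  then show "x = mzero C V (shiftO C i A')" using y(2) j by simp
qed

lemma syzygies_exist:
  assumes "A \<in> Ob C"
  obtains D Y where "D 0 = A" "\<And>i. Y i \<in> X" "\<And>i. conflation (D (Suc i)) (Y i) (D i)"
proof -
  have "\<exists>D. \<forall>i :: nat. (D i \<in> Ob C \<and> (i = 0 \<longrightarrow> D i = A)) \<and> (\<exists>Y \<in> X. conflation (D (Suc i)) Y (D i))"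
  proof (rule dependent_nat_choice)
    fix B and i :: nat assume "B \<in> Ob C \<and> (i = 0 \<longrightarrow> B = A)"
    then have "B \<in> Ob C" by blast
    from approximation_conflation[OF this] obtain B' Y where "Y \<in> X" "conflation B' Y B" .
    then show "\<exists>B'. (B' \<in> Ob C \<and> (Suc i = 0 \<longrightarrow> B' = A)) \<and> (\<exists>Y \<in> X. conflation B' Y B)"
      using conflation_Ob by blast
  qed (use assms in blast)
  then obtain D where D: "D 0 = A" "\<And>i. \<exists>Y \<in> X. conflation (D (Suc i)) Y (D i)" by blast
  then have "\<exists>Y. \<forall>i. Y i \<in> X \<and> conflation (D (Suc i)) (Y i) (D i)"
    by (intro choice) blast
  then show thesis using that D(1) by blast
qed

lemma syzygy_in_X:
  assumes "\<And>i. i < n - 1 \<Longrightarrow> Y i \<in> X" "\<And>i. i < n - 1 \<Longrightarrow> conflation (D (Suc i)) (Y i) (D i)"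
  shows "D (n - 1) \<in> X"
proof -
  have "vanishes i (D i)" if "i \<le> n - 1" for i
    using that
  proof (induction i)
    case 0
    then show ?case by (simp add: vanishes_def)
  next
    case (Suc i)
    then show ?case using syzygy_vanishes[OF assms(2) assms(1), of i i] by auto
  qed
  moreover have "D (n - 1) \<in> Ob C"
    using assms(2)[of "n - 2"] conflation_Ob two_le_n
    by (metis Suc_diff_Suc Suc_1 diff_less_mono2 less_eq_Suc_le lessI order_less_le_trans)
  ultimately show ?thesis by (simp add: X_iff_vanishes)
qed

lemma resolution_exists:
  assumes "A \<in> Ob C"
  obtains Y where "is_resolution C n X A Y"
proof -
  obtain D Y where D: "D 0 = A" and Y: "\<And>i. Y i \<in> X"
    and c: "\<And>i. conflation (D (Suc i)) (Y i) (D i)"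
    using syzygies_exist[OF assms] by metis
  let ?Y = "Y(n - 1 := D (n - 1))"
  have "D (n - 1) \<in> X" using syzygy_in_X Y c by blast
  then have "\<forall>i<n. ?Y i \<in> X" using Y by simp
  moreover have "\<forall>i<n - 1. conflation (D (i + 1)) (?Y i) (D i)" using c by simp
  ultimately have "is_resolution C n X A ?Y"
    unfolding is_resolution_def conflation_def using D by (intro conjI exI[of _ D]) auto
  then show thesis by (rule that)
qed

section \<open>Additivity of the index\<close>

sublocale sp: object_relations C X "split_objects C X"
  by unfold_locales (auto simp: split_objects_def)

abbreviation "Ksp \<equiv> K0_sp C X"

abbreviation "csp \<equiv> cl_sp C X"

lemma comm_group_Ksp: "comm_group Ksp"
  unfolding K0_sp_def by (rule sp.comm_group_K0)

sublocale Ksp: comm_group Ksp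
  by (rule comm_group_Ksp)

lemma csp_closed: "Y \<in> X \<Longrightarrow> csp Y \<in> carrier Ksp"
  unfolding K0_sp_def cl_sp_def by (rule sp.K0_class_closed)

lemma csp_biproduct:
  assumes "A \<in> X" "B \<in> X" "is_biproduct C A B D"
  shows "csp D = csp A \<otimes>\<^bsub>Ksp\<^esub> csp B"
  unfolding K0_sp_def cl_sp_def
  by (rule sp.K0_class_relation) (simp add: split_objects_def assms biproduct_in_X[OF assms])

lemma csp_zero:
  assumes "is_zero_object C Z"
  shows "csp Z = \<one>\<^bsub>Ksp\<^esub>"
proof -
  have "is_biproduct C Z Z Z"
    using biproduct_zero_isomorphic[OF assms isomorphic_refl] assms by (simp add: is_zero_object_def)
  then show ?thesis
    using csp_biproduct[of Z Z Z] zero_object_in_X[OF assms] csp_closed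
    by simp
qed

text \<open>The index is first defined for resolutions of any length \<open>k\<close>, as a relation because it depends a priori
  on the chosen resolution. Independence is a consequence of additivity on conflations.\<close>

inductive index_value :: "nat \<Rightarrow> 'o \<Rightarrow> ('o set \<Rightarrow>\<^sub>0 int) set \<Rightarrow> bool" where
  index_value_0: "Y \<in> X \<Longrightarrow> index_value 0 Y (csp Y)"
| index_value_Suc: "\<lbrakk>conflation A' Y A; Y \<in> X; index_value k A' a\<rbrakk>
    \<Longrightarrow> index_value (Suc k) A (csp Y \<otimes>\<^bsub>Ksp\<^esub> inv\<^bsub>Ksp\<^esub> a)"

inductive_cases index_value_0E: "index_value 0 A a"

inductive_cases index_value_SucE: "index_value (Suc k) A a"

lemma index_value_closed: "index_value k A a \<Longrightarrow> a \<in> carrier Ksp"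
  by (induction rule: index_value.induct) (auto simp: csp_closed)

lemma index_value_zero:
  assumes Z: "is_zero_object C Z"
  shows "index_value k Z \<one>\<^bsub>Ksp\<^esub>"
proof (induction k)
  case 0
  then show ?case using index_value_0[OF zero_object_in_X[OF Z]] csp_zero[OF Z] by simp
next
  case (Suc k)
  have "conflation Z Z Z"
    using biproduct_conflation[OF biproduct_zero_isomorphic[OF Z isomorphic_refl]] Z
    by (simp add: is_zero_object_def)
  from index_value_Suc[OF this zero_object_in_X[OF Z] Suc] csp_zero[OF Z] show ?case by simp
qed

text \<open>Adding \<open>Y\<close> to the object adds it to the first term of the resolution and leaves the syzygy unchanged:
  the approximation of \<open>A\<close> is pulled back along the projection of the biproduct.\<close>

lemma index_value_biproduct:
  assumes A: "index_value k A a" and Y: "Y \<in> X" and E: "is_biproduct C A Y E"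
  shows "index_value k E (a \<otimes>\<^bsub>Ksp\<^esub> csp Y)"
proof (cases k)
  case 0
  then have a: "A \<in> X" "a = csp A" using A by (auto elim: index_value_0E)
  show ?thesis
    using index_value_0[OF biproduct_in_X[OF a(1) Y E]] csp_biproduct[OF a(1) Y E] a(2) 0 by simp
next
  case (Suc j)
  then obtain A' V b where c: "conflation A' V A" and V: "V \<in> X" and b: "index_value j A' b"
    and a: "a = csp V \<otimes>\<^bsub>Ksp\<^esub> inv\<^bsub>Ksp\<^esub> b"
    using A by (auto elim: index_value_SucE)
  obtain W where W: "conflation A' W E" "is_biproduct C Y V W"
    using conflation_pullback[OF biproduct_conflation[OF biproduct_commute[OF E]] c V] .
  have "index_value k E (csp W \<otimes>\<^bsub>Ksp\<^esub> inv\<^bsub>Ksp\<^esub> b)"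
    using index_value_Suc[OF W(1) biproduct_in_X[OF Y V W(2)] b] Suc by simp
  moreover have "csp W \<otimes>\<^bsub>Ksp\<^esub> inv\<^bsub>Ksp\<^esub> b = a \<otimes>\<^bsub>Ksp\<^esub> csp Y"
    using csp_biproduct[OF Y V W(2)] a csp_closed[OF Y] csp_closed[OF V] index_value_closed[OF b]
    by (simp add: Ksp.m_ac)
  ultimately show ?thesis by simp
qed

text \<open>The three syzygies \<open>A'\<close>, \<open>B'\<close>, \<open>D'\<close> need not form a conflation, since the approximation of \<open>B\<close> is
  unrelated to those of \<open>A\<close> and \<open>D\<close>. As in Schanuel's lemma, they do so after adding objects of \<open>X\<close>:
  repeated pullbacks lead to a conflation
  \<open>A' \<rightarrow> B' \<oplus> W \<oplus> U \<rightarrow> D' \<oplus> V\<close>, where \<open>U\<close>, \<open>V\<close>, \<open>W\<close> approximate \<open>A\<close>, \<open>B\<close>, \<open>D\<close>. The induction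
  hypothesis applies to it.\<close>

lemma index_value_additive:
  assumes "index_value k A a" "index_value k B b" "index_value k D d" "conflation A B D"
  shows "b = a \<otimes>\<^bsub>Ksp\<^esub> d"
  using assms
proof (induction k arbitrary: A a B b D d)
  case 0
  then have "A \<in> X" "a = csp A" "b = csp B" "D \<in> X" "d = csp D" by (auto elim!: index_value_0E)
  then show ?case using csp_biproduct conflation_onto_X_splits[OF 0(4)] by blast
next
  case (Suc k)
  obtain A' U a' where U: "conflation A' U A" "U \<in> X" "index_value k A' a'"
    and a: "a = csp U \<otimes>\<^bsub>Ksp\<^esub> inv\<^bsub>Ksp\<^esub> a'" using Suc.prems(1) by (auto elim: index_value_SucE)
  obtain B' V b' where V: "conflation B' V B" "V \<in> X" "index_value k B' b'"
    and b: "b = csp V \<otimes>\<^bsub>Ksp\<^esub> inv\<^bsub>Ksp\<^esub> b'" using Suc.prems(2) by (auto elim: index_value_SucE)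
  obtain D' W d' where W: "conflation D' W D" "W \<in> X" "index_value k D' d'"
    and d: "d = csp W \<otimes>\<^bsub>Ksp\<^esub> inv\<^bsub>Ksp\<^esub> d'" using Suc.prems(3) by (auto elim: index_value_SucE)
  obtain E where E: "conflation D' E B" "is_biproduct C A W E"
    using conflation_pullback[OF Suc.prems(4) W(1,2)] .
  obtain F where F: "conflation B' F E" "is_biproduct C D' V F"
    using conflation_pullback[OF E(1) V(1,2)] .
  \<comment> \<open>The conflations from \<open>P\<close> and from \<open>F\<close> end both in \<open>E\<close>; their pullback \<open>H\<close> links \<open>A'\<close> to \<open>B'\<close>.\<close>
  obtain P where P: "conflation A' P E" "is_biproduct C W U P"
    using conflation_pullback[OF biproduct_conflation[OF biproduct_commute[OF E(2)]] U(1,2)] .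
  have PX: "P \<in> X" using biproduct_in_X[OF W(2) U(2) P(2)] .
  obtain H where H: "conflation A' H F" "is_biproduct C B' P H"
    using conflation_pullback[OF F(1) P(1) PX] .
  note closed = csp_closed[OF U(2)] csp_closed[OF V(2)] csp_closed[OF W(2)]
    index_value_closed[OF U(3)] index_value_closed[OF V(3)] index_value_closed[OF W(3)]
  have "b' \<otimes>\<^bsub>Ksp\<^esub> csp P = a' \<otimes>\<^bsub>Ksp\<^esub> (d' \<otimes>\<^bsub>Ksp\<^esub> csp V)"
    using Suc.IH[OF U(3) index_value_biproduct[OF V(3) PX H(2)]
        index_value_biproduct[OF W(3) V(2) F(2)] H(1)] .
  then have "b' \<otimes>\<^bsub>Ksp\<^esub> (csp W \<otimes>\<^bsub>Ksp\<^esub> csp U) = a' \<otimes>\<^bsub>Ksp\<^esub> (d' \<otimes>\<^bsub>Ksp\<^esub> csp V)"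
    using csp_biproduct[OF W(2) U(2) P(2)] by simp
  then show ?case
    unfolding a b d by (rule Ksp.rearrange_differences) (use closed in auto)
qed

text \<open>Additivity on the conflation \<open>0 \<rightarrow> B \<rightarrow> A\<close> given by an isomorphism.\<close>

lemma index_value_unique:
  assumes "index_value k A a" "index_value k B b" "isomorphic C A B"
  shows "a = b"
proof -
  obtain Z where Z: "is_zero_object C Z" using zero_object_exists by blast
  have "b = \<one>\<^bsub>Ksp\<^esub> \<otimes>\<^bsub>Ksp\<^esub> a"
    using index_value_additive[OF index_value_zero[OF Z] assms(2,1)]
      biproduct_conflation[OF biproduct_zero_isomorphic[OF Z assms(3)]] by simp
  then show ?thesis using index_value_closed[OF assms(1)] by simp
qed

lemma index_value_spliced:
  assumes "\<And>i. i \<le> k \<Longrightarrow> Y i \<in> X" "\<And>i. i < k \<Longrightarrow> conflation (D (Suc i)) (Y i) (D i)" "D k = Y k"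
  shows "index_value k (D 0) (alt_prod Ksp (Suc k) (\<lambda>i. csp (Y i)))"
  using assms
proof (induction k arbitrary: D Y)
  case 0
  then show ?case using index_value_0[of "Y 0"] csp_closed[of "Y 0"]
    by (subst Ksp.alt_prod_Suc) auto
next
  case (Suc k)
  have "index_value k (D (Suc 0)) (alt_prod Ksp (Suc k) (\<lambda>i. csp (Y (Suc i))))"
    by (rule Suc.IH[of "\<lambda>i. Y (Suc i)" "\<lambda>i. D (Suc i)"]) (use Suc.prems in auto)
  from index_value_Suc[OF _ _ this] Suc.prems
  have "index_value (Suc k) (D 0)
      (csp (Y 0) \<otimes>\<^bsub>Ksp\<^esub> inv\<^bsub>Ksp\<^esub> alt_prod Ksp (Suc k) (\<lambda>i. csp (Y (Suc i))))" by blast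
  then show ?case using Suc.prems(1) csp_closed by (subst Ksp.alt_prod_Suc) auto
qed

lemma index_value_resolution:
  assumes "is_resolution C n X A Y"
  shows "index_value (n - 1) A (alt_sum_sp C X n Y)"
proof -
  obtain D where D: "D 0 = A" "D (n - 1) = Y (n - 1)"
    and c: "\<And>i. i < n - 1 \<Longrightarrow> conflation (D (Suc i)) (Y i) (D i)" and Y: "\<And>i. i < n \<Longrightarrow> Y i \<in> X"
    using assms unfolding is_resolution_def conflation_def by auto
  have "index_value (n - 1) (D 0) (alt_prod Ksp (Suc (n - 1)) (\<lambda>i. csp (Y i)))"
    by (rule index_value_spliced) (use D c Y two_le_n in auto)
  then show ?thesis using D(1) two_le_n by (simp add: alt_sum_sp_alt_prod)
qed

end

section \<open>The index isomorphism\<close>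

context cluster_tilting_subcategory
begin

definition "ind A = (THE a. index_value (n - 1) A a)"

lemma ind_eq:
  assumes "A \<in> Ob C" "index_value (n - 1) A a"
  shows "ind A = a"
  unfolding ind_def
proof (rule the_equality)
  show "b = a" if "index_value (n - 1) A b" for b
    using index_value_unique[OF that assms(2) isomorphic_refl[OF assms(1)]] .
qed (rule assms(2))

lemma ind_value: "A \<in> Ob C \<Longrightarrow> index_value (n - 1) A (ind A)"
  using resolution_exists index_value_resolution ind_eq by metis

lemma ind_closed: "A \<in> Ob C \<Longrightarrow> ind A \<in> carrier Ksp"
  using index_value_closed ind_value by blast

lemma ind_resolution: "\<lbrakk>A \<in> Ob C; is_resolution C n X A Y\<rbrakk> \<Longrightarrow> ind A = alt_sum_sp C X n Y"
  using index_value_resolution ind_eq by blast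

lemma ind_isomorphic:
  assumes "isomorphic C A B"
  shows "ind A = ind B"
  using index_value_unique[OF ind_value ind_value assms] isomorphic_objects[OF assms] by blast

lemma ind_conflation:
  assumes "conflation A B D"
  shows "ind B = ind A \<otimes>\<^bsub>Ksp\<^esub> ind D"
  using index_value_additive[OF ind_value ind_value ind_value assms] conflation_Ob[OF assms] by blast

lemma ind_X:
  assumes Y: "Y \<in> X"
  shows "ind Y = csp Y"
proof -
  obtain Z where Z: "is_zero_object C Z" using zero_object_exists by blast
  have "index_value (n - 1) Y (\<one>\<^bsub>Ksp\<^esub> \<otimes>\<^bsub>Ksp\<^esub> csp Y)"
    using index_value_biproduct[OF index_value_zero[OF Z] Y]
      biproduct_zero_isomorphic[OF Z isomorphic_refl[OF X_object[OF Y]]] by blast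
  then show ?thesis using ind_eq[OF X_object[OF Y]] csp_closed[OF Y] by simp
qed

text \<open>If all conflations are among the relations, then \<open>[Y] \<mapsto> [Y]\<close> is well defined on
  $K_0^{\mathsf{sp}}(\mathcal{X})$, as biproducts give split conflations. It sends the index of \<open>A\<close> to the class of \<open>A\<close>
  because the alternating sum over a resolution telescopes. This serves both
  $K_0(\mathcal{C}^{\mathcal{X}}_R)$ and $K_0(\mathcal{C})$.\<close>

lemma hom_from_Ksp:
  assumes T: "object_relations (Ob C) T" "\<And>A B D. conflation A B D \<Longrightarrow> (A, B, D) \<in> T"
  obtains \<psi> where "\<psi> \<in> hom Ksp (K0_group C (Ob C) T)"
    "\<And>Y. Y \<in> X \<Longrightarrow> \<psi> (csp Y) = K0_class C (Ob C) T Y"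
    "\<And>A. A \<in> Ob C \<Longrightarrow> \<psi> (ind A) = K0_class C (Ob C) T A"
proof -
  interpret T: object_relations C "Ob C" T by fact
  let ?H = "K0_group C (Ob C) T" and ?c = "K0_class C (Ob C) T"
  interpret H: comm_group ?H by (rule T.comm_group_K0)
  have rel: "?c B = ?c A \<otimes>\<^bsub>?H\<^esub> ?c D" if "conflation A B D" for A B D
    using T.K0_class_relation T(2) that by blast
  have iso: "?c A = ?c B" if "A \<in> X" "B \<in> X" "iso_class C X A = iso_class C X B" for A B
    using that iso_class_eq_iff[of A X B] iso_class_eq_iff[of A "Ob C" B] X_objects X_object
    by (simp add: K0_class_def)
  obtain \<psi> where \<psi>: "\<psi> \<in> hom Ksp ?H" "\<And>Y. Y \<in> X \<Longrightarrow> \<psi> (csp Y) = ?c Y"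
  proof (rule sp.K0_universal[OF T.comm_group_K0, of ?c])
    show "?c A \<in> carrier ?H" if "A \<in> X" for A using that X_object T.K0_class_closed by blast
    show "?c B = ?c A \<otimes>\<^bsub>?H\<^esub> ?c D" if "(A, B, D) \<in> split_objects C X" for A B D
      using that rel biproduct_conflation by (auto simp: split_objects_def)
    show "?c A = ?c B" if "A \<in> X" "B \<in> X" "iso_class C X A = iso_class C X B" for A B
      using that by (rule iso)
  qed (simp add: K0_sp_def cl_sp_def)
  have "\<psi> (ind A) = ?c A" if A: "A \<in> Ob C" for A
  proof -
    obtain Y where Y: "is_resolution C n X A Y" using resolution_exists[OF A] .
    then obtain D where D: "D 0 = A" "D (n - 1) = Y (n - 1)"
      and c: "\<And>i. i < n - 1 \<Longrightarrow> conflation (D (Suc i)) (Y i) (D i)" and YX: "\<And>i. i < n \<Longrightarrow> Y i \<in> X"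
      unfolding is_resolution_def conflation_def by auto
    have Dob: "D i \<in> Ob C" if "i \<le> n - 1" for i
      using c[of i] conflation_Ob D(2) YX[of "n - 1"] X_object two_le_n that
      by (cases "i = n - 1") auto
    have "\<psi> (ind A) = alt_prod ?H n (\<lambda>i. \<psi> (csp (Y i)))"
      unfolding ind_resolution[OF A Y] alt_sum_sp_alt_prod
      by (rule Ksp.alt_prod_hom[OF H.comm_group_axioms \<psi>(1)]) (use YX csp_closed in blast)
    also have "\<dots> = alt_prod ?H (Suc (n - 1)) (\<lambda>i. \<psi> (csp (Y i)))" using two_le_n by simp
    also have "\<dots> = ?c (D 0)"
    proof (rule H.alt_prod_telescope)
      show "?c (D i) \<in> carrier ?H" if "i \<le> n - 1" for i using Dob[OF that] T.K0_class_closed by blast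
      show "\<psi> (csp (Y i)) = ?c (D i) \<otimes>\<^bsub>?H\<^esub> ?c (D (Suc i))" if "i < n - 1" for i
      proof -
        have "\<psi> (csp (Y i)) = ?c (D (Suc i)) \<otimes>\<^bsub>?H\<^esub> ?c (D i)"
          using \<psi>(2)[OF YX, of i] rel[OF c, of i] that by simp
        then show ?thesis
          using H.m_comm[of "?c (D (Suc i))" "?c (D i)"] T.K0_class_closed Dob that by simp
      qed
      show "\<psi> (csp (Y (n - 1))) = ?c (D (n - 1))" using \<psi>(2)[OF YX, of "n - 1"] D(2) two_le_n by simp
    qed
    finally show ?thesis using D(1) by simp
  qed
  with \<psi> show thesis by (rule that)
qed

sublocale R: object_relations C "Ob C" "conflation_objects C X"
  by unfold_locales (use conflation_Ob in \<open>auto simp: conflation_objects_def conflation_def\<close>)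

lemma cl_R_closed: "A \<in> Ob C \<Longrightarrow> cl_R C X A \<in> carrier (K0_R C X)"
  unfolding cl_R_def K0_R_def by (rule R.K0_class_closed)

lemma index_isomorphism_exists:
  obtains \<phi> where "is_index_isomorphism C n X \<phi>" "\<And>A. A \<in> Ob C \<Longrightarrow> \<phi> (cl_R C X A) = ind A"
proof -
  obtain \<phi> where \<phi>: "\<phi> \<in> hom (K0_R C X) Ksp" "\<And>A. A \<in> Ob C \<Longrightarrow> \<phi> (cl_R C X A) = ind A"
  proof (rule R.K0_universal[OF comm_group_Ksp, of ind])
    show "ind A = ind B"
      if "A \<in> Ob C" "B \<in> Ob C" "iso_class C (Ob C) A = iso_class C (Ob C) B" for A B
      using that ind_isomorphic iso_class_eq_iff by blast
    show "ind B = ind A \<otimes>\<^bsub>Ksp\<^esub> ind D" if "(A, B, D) \<in> conflation_objects C X" for A B D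
      using that ind_conflation by (auto simp: conflation_objects_def conflation_def)
  qed (simp_all add: K0_R_def cl_R_def ind_closed)
  obtain \<psi> where \<psi>: "\<psi> \<in> hom Ksp (K0_R C X)" "\<And>Y. Y \<in> X \<Longrightarrow> \<psi> (csp Y) = cl_R C X Y"
    "\<And>A. A \<in> Ob C \<Longrightarrow> \<psi> (ind A) = cl_R C X A"
  proof (rule hom_from_Ksp[OF R.object_relations_axioms])
    show "(A, B, D) \<in> conflation_objects C X" if "conflation A B D" for A B D
      using that by (auto simp: conflation_objects_def conflation_def)
  qed (simp add: K0_R_def cl_R_def)
  have grp: "group (K0_R C X)"
    using R.comm_group_K0 by (simp add: K0_R_def comm_group.axioms(2))
  have "\<psi> (\<phi> x) = x" if "x \<in> carrier (K0_R C X)" for x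
    using R.K0_hom_eqI[of "K0_R C X" "\<psi> \<circ> \<phi>" id x] grp Group.hom_compose[OF \<phi>(1) \<psi>(1)] \<phi>(2) \<psi>(3) that
    by (simp add: K0_R_def cl_R_def hom_def)
  moreover have "\<phi> (\<psi> y) = y" if "y \<in> carrier Ksp" for y
    using sp.K0_hom_eqI[of Ksp "\<phi> \<circ> \<psi>" id y] Group.hom_compose[OF \<psi>(1) \<phi>(1)]
      \<psi>(2) \<phi>(2) ind_X X_object that Ksp.is_group
    by (simp add: K0_sp_def cl_sp_def hom_def)
  ultimately have iso: "\<phi> \<in> iso (K0_R C X) Ksp" using inverse_homs_imp_iso[OF \<phi>(1) \<psi>(1)] by blast
  let ?\<phi> = "restrict \<phi> (carrier (K0_R C X))"
  have v: "?\<phi> (cl_R C X A) = ind A" if "A \<in> Ob C" for A using that cl_R_closed \<phi>(2) by simp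
  have "?\<phi> \<in> iso (K0_R C X) Ksp"
    using iso group.is_monoid[OF grp] monoid.m_closed by (fastforce simp: iso_def hom_def bij_betw_def inj_on_def)
  then have "is_index_isomorphism C n X ?\<phi>"
    unfolding is_index_isomorphism_def using v ind_resolution by auto
  then show thesis using v by (rule that)
qed

lemma index_isomorphism_unique:
  assumes \<phi>: "is_index_isomorphism C n X \<phi>" and \<phi>': "is_index_isomorphism C n X \<phi>'"
  shows "\<phi> = \<phi>'"
proof (rule extensionalityI)
  show "\<phi> \<in> extensional (carrier (K0_R C X))" "\<phi>' \<in> extensional (carrier (K0_R C X))"
    using \<phi> \<phi>' by (auto simp: is_index_isomorphism_def)
  have hom: "\<phi> \<in> hom (K0_R C X) Ksp" "\<phi>' \<in> hom (K0_R C X) Ksp"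
    using \<phi> \<phi>' by (auto simp: is_index_isomorphism_def iso_def)
  have "\<phi> (cl_R C X A) = \<phi>' (cl_R C X A)" if A: "A \<in> Ob C" for A
  proof -
    obtain Y where "is_resolution C n X A Y" using resolution_exists[OF A] .
    then show ?thesis using \<phi> \<phi>' A by (simp add: is_index_isomorphism_def)
  qed
  then show "\<phi> x = \<phi>' x" if "x \<in> carrier (K0_R C X)" for x
    using R.K0_hom_eqI[of Ksp \<phi> \<phi>' x] hom that Ksp.is_group by (simp add: K0_R_def cl_R_def)
qed

lemma index_eq:
  shows "is_index_isomorphism C n X (index C n X)"
    and "A \<in> Ob C \<Longrightarrow> index C n X (cl_R C X A) = ind A"
proof -
  obtain \<phi> where \<phi>: "is_index_isomorphism C n X \<phi>" "\<And>A. A \<in> Ob C \<Longrightarrow> \<phi> (cl_R C X A) = ind A"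
    using index_isomorphism_exists by blast
  have "index C n X = \<phi>"
    unfolding index_def by (rule the_equality) (use \<phi>(1) index_isomorphism_unique in auto)
  with \<phi> show "is_index_isomorphism C n X (index C n X)"
    "A \<in> Ob C \<Longrightarrow> index C n X (cl_R C X A) = ind A" by auto
qed

section \<open>Angles and triangles\<close>

sublocale ang: quotient_by_relations Ksp "{alt_sum_sp C X (n + 2) Y | Y. \<exists>d h. is_angle C n X Y d h}"
proof -
  have "alt_sum_sp C X (n + 2) Y \<in> carrier Ksp" if "is_angle C n X Y d h" for Y d h
    unfolding alt_sum_sp_alt_prod
    by (rule Ksp.alt_prod_closed) (use that csp_closed in \<open>auto simp: is_angle_def\<close>)
  then show "quotient_by_relations Ksp {alt_sum_sp C X (n + 2) Y | Y. \<exists>d h. is_angle C n X Y d h}"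
    using comm_group_Ksp by (auto simp: quotient_by_relations_def quotient_by_relations_axioms_def)
qed

abbreviation "Kang \<equiv> K0_ang C n X"

lemma K0_ang_eq: "Kang = ang.Q"
  by (simp add: K0_ang_def angle_relations_def)

lemma proj_ang_eq: "proj_ang C n X = ang.quot"
  by (simp add: proj_ang_def angle_relations_def fun_eq_iff)

sublocale Kang: comm_group Kang
  unfolding K0_ang_eq by (rule ang.comm_group_quotient)

sublocale proj: group_hom Ksp Kang "proj_ang C n X"
  unfolding K0_ang_eq proj_ang_eq
  using ang.quot_hom ang.comm_group_quotient Ksp.is_group
  by (simp add: group_hom_def group_hom_axioms_def comm_group.axioms(2))

definition "ang_class A = proj_ang C n X (ind A)"

lemma ang_class_closed: "A \<in> Ob C \<Longrightarrow> ang_class A \<in> carrier Kang"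
  unfolding ang_class_def using ind_closed by simp

lemma ang_class_conflation: "conflation A B D \<Longrightarrow> ang_class B = ang_class A \<otimes>\<^bsub>Kang\<^esub> ang_class D"
  unfolding ang_class_def using ind_conflation ind_closed conflation_Ob by simp

lemma distinguished_choice:
  assumes "\<And>i :: nat. conflation (D (Suc i)) (Y i) (D i)"
  obtains u v w where "\<And>i. distinguished (D (Suc i)) (Y i) (D i) (u i) (v i) (w i)"
proof -
  have "\<forall>i. \<exists>u v w. distinguished (D (Suc i)) (Y i) (D i) u v w"
    using assms unfolding conflation_iff by blast
  then show thesis using that by metis
qed

text \<open>The \<open>n\<close> terms of a resolution of \<open>A\<close>, spliced with the triangle, form a sequence
  \<open>V' (n - 1), \<dots>, V' 0, B, D\<close> in \<open>X\<close>, which is an \<open>(n + 2)\<close>-angle. Its alternating sum is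
  \<open>[D] - [B] + ind A\<close>.\<close>

lemma ang_class_triangle_in_X:
  assumes t: "distinguished A B D f g h" and B: "B \<in> X" and D: "D \<in> X"
  shows "ang_class B = ang_class A \<otimes>\<^bsub>Kang\<^esub> ang_class D"
proof -
  have Aob: "A \<in> Ob C" using triangleD[OF t] by blast
  obtain E V where E0: "E 0 = A" and V: "\<And>i. V i \<in> X"
    and c: "\<And>i. conflation (E (Suc i)) (V i) (E i)"
    using syzygies_exist[OF Aob] by metis
  have EX: "E (n - 1) \<in> X" using syzygy_in_X V c by blast
  obtain u v w where uvw: "\<And>i. distinguished (E (Suc i)) (V i) (E i) (u i) (v i) (w i)"
    using distinguished_choice[of E V, OF c] by metis
  \<comment> \<open>The functions below carry the indices of an angle: index \<open>1\<close> is the given triangle, index \<open>i \<ge> 2\<close> the conflation \<open>i - 2\<close> of the resolution.\<close>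
  define V' where "V' = V(n - 1 := E (n - 1))"
  define Y where "Y i = (if i = 0 then D else if i = 1 then B else V' (i - 2))" for i
  define D' where "D' i = (if i = 1 then D else E (i - 2))" for i
  define f' where "f' i = (if i = 1 then f else u (i - 2))" for i
  define g' where "g' i = (if i = 1 then g else v (i - 2))" for i
  define h' where "h' i = (if i = 1 then h else w (i - 2))" for i
  define d where "d i = (if i = 0 then g' 1 else if i = n then f' n else f' i \<cdot> g' (i + 1))" for i
  have V'X: "V' i \<in> X" for i using V EX by (simp add: V'_def)
  have YX: "Y i \<in> X" for i using B D V'X by (simp add: Y_def)
  have tri: "distinguished (D' (i + 1)) (Y i) (D' i) (f' i) (g' i) (h' i)" if i: "i \<in> {1..n}" for i
  proof (cases "i = 1")
    case True
    then show ?thesis using t E0 by (simp add: D'_def Y_def f'_def g'_def h'_def)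
  next
    case False
    then have "i - 1 = Suc (i - 2)" "V' (i - 2) = V (i - 2)" using i by (auto simp: V'_def)
    then show ?thesis using uvw[of "i - 2"] False i by (simp add: D'_def Y_def f'_def g'_def h'_def)
  qed
  have "is_angle C n X Y d (connecting C (Y 0) h' n)"
    unfolding is_angle_def
  proof (rule conjI; (rule exI[of _ D'], rule exI[of _ f'], rule exI[of _ g'], rule exI[of _ h'], intro conjI)?)
    show "\<forall>i\<in>{1..n}. f' i \<in> Mor C (D' (i + 1)) (Y i) \<and> g' i \<in> Mor C (Y i) (D' i) \<and>
        h' i \<in> Mor C (D' i) (shO C (D' (i + 1))) \<and> (f' i, g' i, h' i) \<in> dtri C"
      using tri unfolding distinguished_def by blast
    show "D' (n + 1) = Y (n + 1)" using two_le_n by (simp add: D'_def Y_def V'_def)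
  qed (use YX two_le_n in \<open>auto simp: D'_def Y_def d_def\<close>)
  then have "proj_ang C n X (alt_sum_sp C X (n + 2) Y) = \<one>\<^bsub>Kang\<^esub>"
    unfolding proj_ang_eq K0_ang_eq by (intro ang.quot_relation) blast
  moreover have "alt_sum_sp C X (n + 2) Y = ind D \<otimes>\<^bsub>Ksp\<^esub> inv\<^bsub>Ksp\<^esub> (ind B \<otimes>\<^bsub>Ksp\<^esub> inv\<^bsub>Ksp\<^esub> ind A)"
  proof -
    have "index_value (n - 1) (E 0) (alt_prod Ksp (Suc (n - 1)) (\<lambda>i. csp (V' i)))"
      by (rule index_value_spliced) (use V'X c in \<open>auto simp: V'_def\<close>)
    then have "ind A = alt_prod Ksp n (\<lambda>i. csp (Y (Suc (Suc i))))"
      using ind_eq[OF Aob] E0 two_le_n by (simp add: Y_def)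
    moreover have "alt_sum_sp C X (n + 2) Y = csp (Y 0) \<otimes>\<^bsub>Ksp\<^esub> inv\<^bsub>Ksp\<^esub>
        (csp (Y 1) \<otimes>\<^bsub>Ksp\<^esub> inv\<^bsub>Ksp\<^esub> alt_prod Ksp n (\<lambda>i. csp (Y (Suc (Suc i)))))"
      using YX csp_closed by (simp add: alt_sum_sp_alt_prod Ksp.alt_prod_Suc)
    moreover have "csp (Y 0) = ind D" "csp (Y 1) = ind B"
      using ind_X[OF B] ind_X[OF D] by (simp_all add: Y_def)
    ultimately show ?thesis by simp
  qed
  moreover have "ind A \<in> carrier Ksp" "ind B \<in> carrier Ksp" "ind D \<in> carrier Ksp"
    using ind_closed Aob X_object B D by auto
  ultimately have "ang_class D \<otimes>\<^bsub>Kang\<^esub>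
      inv\<^bsub>Kang\<^esub> (ang_class B \<otimes>\<^bsub>Kang\<^esub> inv\<^bsub>Kang\<^esub> ang_class A) = \<one>\<^bsub>Kang\<^esub>"
    by (simp add: ang_class_def)
  moreover have closed: "ang_class A \<in> carrier Kang" "ang_class B \<in> carrier Kang"
      "ang_class D \<in> carrier Kang"
    using ang_class_closed Aob X_object B D by auto
  ultimately have "ang_class D = ang_class B \<otimes>\<^bsub>Kang\<^esub> inv\<^bsub>Kang\<^esub> ang_class A"
    using Kang.inv_equality[of "ang_class D"
        "inv\<^bsub>Kang\<^esub> (ang_class B \<otimes>\<^bsub>Kang\<^esub> inv\<^bsub>Kang\<^esub> ang_class A)"] by simp
  then show ?thesis
    using closed Kang.m_lcomm[of "ang_class A" "ang_class B" "inv\<^bsub>Kang\<^esub> ang_class A"] by simp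
qed

text \<open>Rotated back, the triangle ends in \<open>B\<close>, and it can be pulled back along an approximation \<open>V\<close> of \<open>B\<close>.
  The syzygy of \<open>B\<close> then enters the classes of \<open>A\<close> and \<open>B\<close> alike and cancels. This leaves a triangle
  \<open>F \<rightarrow> V \<rightarrow> D\<close> whose last two objects lie in \<open>X\<close>.\<close>

lemma ang_class_triangle_onto_X:
  assumes t: "distinguished A B D f g h" and D: "D \<in> X"
  shows "ang_class B = ang_class A \<otimes>\<^bsub>Kang\<^esub> ang_class D"
proof -
  have ob: "A \<in> Ob C" "B \<in> Ob C" "D \<in> Ob C" using triangleD[OF t] by blast+
  obtain B' V where V: "V \<in> X" and c: "conflation B' V B"
    using approximation_conflation[OF ob(2)] .
  obtain Z w k where Z: "distinguished Z A B w f k" "isomorphic C D (shO C Z)"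
    using triangle_rotate_back[OF t] .
  obtain F f' g' y where F: "conflation B' F A" "y \<in> Mor C V B" "distinguished Z F V f' g' (k \<cdot> y)"
    using triangle_conflation_pullback[OF Z(1) c] .
  have "ang_class V = ang_class F \<otimes>\<^bsub>Kang\<^esub> ang_class (shO C Z)"
    using ang_class_triangle_in_X[OF triangle_rotate[OF F(3)] V isomorphic_in_X[OF D Z(2)]] .
  also have "ang_class (shO C Z) = ang_class D"
    unfolding ang_class_def using ind_isomorphic[OF Z(2)] by simp
  finally have "ang_class B' \<otimes>\<^bsub>Kang\<^esub> ang_class B
      = ang_class B' \<otimes>\<^bsub>Kang\<^esub> (ang_class A \<otimes>\<^bsub>Kang\<^esub> ang_class D)"
    using ang_class_conflation[OF c] ang_class_conflation[OF F(1)] conflation_Ob[OF c] ob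
    by (simp add: ang_class_closed Kang.m_assoc)
  then show ?thesis using conflation_Ob[OF c] ob by (simp add: ang_class_closed)
qed

text \<open>Pulling back along an approximation \<open>W\<close> of \<open>D\<close> changes the classes of \<open>B\<close> and \<open>D\<close> by that of the
  syzygy of \<open>D\<close> and replaces \<open>D\<close> by an object of \<open>X\<close>.\<close>

lemma ang_class_triangle:
  assumes t: "distinguished A B D f g h"
  shows "ang_class B = ang_class A \<otimes>\<^bsub>Kang\<^esub> ang_class D"
proof -
  have ob: "A \<in> Ob C" "B \<in> Ob C" "D \<in> Ob C" using triangleD[OF t] by blast+
  obtain D' W where W: "W \<in> X" and c: "conflation D' W D"
    using approximation_conflation[OF ob(3)] .
  obtain E f' g' y where E: "conflation D' E B" "y \<in> Mor C W D" "distinguished A E W f' g' (h \<cdot> y)"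
    using triangle_conflation_pullback[OF t c] .
  have "ang_class D' \<otimes>\<^bsub>Kang\<^esub> ang_class B = ang_class A \<otimes>\<^bsub>Kang\<^esub> (ang_class D' \<otimes>\<^bsub>Kang\<^esub> ang_class D)"
    using ang_class_triangle_onto_X[OF E(3) W] ang_class_conflation[OF E(1)] ang_class_conflation[OF c]
    by simp
  also have "\<dots> = ang_class D' \<otimes>\<^bsub>Kang\<^esub> (ang_class A \<otimes>\<^bsub>Kang\<^esub> ang_class D)"
    using conflation_Ob[OF c] ob by (simp add: ang_class_closed Kang.m_lcomm)
  finally show ?thesis using conflation_Ob[OF c] ob by (simp add: ang_class_closed)
qed

sublocale tri: object_relations C "Ob C" "triangle_objects C"
  by unfold_locales (use Mor_objects in \<open>auto simp: triangle_objects_def\<close>)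

text \<open>In $K_0(\mathcal{C})$ the alternating sum over \<open>Y 1, \<dots>, Y (n + 1)\<close> telescopes to the class of the first object
  \<open>D 1 = Y 0\<close>.\<close>

lemma angle_sum_vanishes:
  assumes ang: "is_angle C n X Y d h"
    and \<psi>: "\<psi> \<in> hom Ksp (K0 C)" "\<And>Y. Y \<in> X \<Longrightarrow> \<psi> (csp Y) = cl C Y"
  shows "\<psi> (alt_sum_sp C X (n + 2) Y) = \<one>\<^bsub>K0 C\<^esub>"
proof -
  interpret K0: comm_group "K0 C" unfolding K0_def by (rule tri.comm_group_K0)
  have closed: "A \<in> Ob C \<Longrightarrow> cl C A \<in> carrier (K0 C)" for A
    unfolding K0_def cl_def by (rule tri.K0_class_closed)
  have YX: "Y i \<in> X" if "i \<le> n + 1" for i using ang that by (auto simp: is_angle_def)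
  obtain D where D: "D 1 = Y 0" "D (n + 1) = Y (n + 1)"
    and t: "\<And>i. i \<in> {1..n} \<Longrightarrow> (D (i + 1), Y i, D i) \<in> triangle_objects C"
    using ang unfolding is_angle_def triangle_objects_def by blast
  have Dob: "D i \<in> Ob C" if "i \<in> {1..n + 1}" for i
    using tri.relation_objects[OF t, of i] D(2) YX[of "n + 1"] X_object that
    by (cases "i = n + 1") auto
  have "\<psi> (alt_sum_sp C X (n + 2) Y) = alt_prod (K0 C) (n + 2) (\<lambda>i. \<psi> (csp (Y i)))"
    unfolding alt_sum_sp_alt_prod
    by (rule Ksp.alt_prod_hom[OF K0.comm_group_axioms \<psi>(1)]) (use YX csp_closed in auto)
  also have "\<dots> = cl C (Y 0) \<otimes>\<^bsub>K0 C\<^esub> inv\<^bsub>K0 C\<^esub> alt_prod (K0 C) (Suc n) (\<lambda>i. \<psi> (csp (Y (Suc i))))"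
    using K0.alt_prod_Suc[of "Suc n" "\<lambda>i. \<psi> (csp (Y i))"] YX X_object closed \<psi>(2) by simp
  also have "alt_prod (K0 C) (Suc n) (\<lambda>i. \<psi> (csp (Y (Suc i)))) = cl C (D (Suc 0))"
  proof (rule K0.alt_prod_telescope)
    show "cl C (D (Suc i)) \<in> carrier (K0 C)" if "i \<le> n" for i using Dob that closed by simp
    show "\<psi> (csp (Y (Suc i))) = cl C (D (Suc i)) \<otimes>\<^bsub>K0 C\<^esub> cl C (D (Suc (Suc i)))" if "i < n" for i
    proof -
      have "cl C (Y (Suc i)) = cl C (D (Suc (Suc i))) \<otimes>\<^bsub>K0 C\<^esub> cl C (D (Suc i))"
        unfolding K0_def cl_def using tri.K0_class_relation[OF t, of "Suc i"] that by simp
      then show ?thesis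
        using \<psi>(2)[OF YX, of "Suc i"] that K0.m_comm[OF closed closed, of "D (Suc (Suc i))" "D (Suc i)"] Dob
        by simp
    qed
    show "\<psi> (csp (Y (Suc n))) = cl C (D (Suc n))" using \<psi>(2)[OF YX, of "Suc n"] D(2) by simp
  qed
  finally show ?thesis using D(1) closed[OF X_object[OF YX[of 0]]] by simp
qed

theorem K0_iso_K0_ang:
  "\<exists>\<Phi> \<in> iso (K0 C) Kang. \<forall>A \<in> Ob C. \<Phi> (cl C A) = ang_class A"
proof -
  obtain \<Phi> where \<Phi>: "\<Phi> \<in> hom (K0 C) Kang" "\<And>A. A \<in> Ob C \<Longrightarrow> \<Phi> (cl C A) = ang_class A"
  proof (rule tri.K0_universal[OF Kang.comm_group_axioms, of ang_class])
    show "ang_class A = ang_class B"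
      if "A \<in> Ob C" "B \<in> Ob C" "iso_class C (Ob C) A = iso_class C (Ob C) B" for A B
      unfolding ang_class_def using that ind_isomorphic[of A B] iso_class_eq_iff[of A "Ob C" B] by simp
    show "ang_class B = ang_class A \<otimes>\<^bsub>Kang\<^esub> ang_class D" if "(A, B, D) \<in> triangle_objects C" for A B D
      using that ang_class_triangle unfolding triangle_objects_def distinguished_def by blast
  qed (simp_all add: K0_def cl_def ang_class_closed)
  obtain \<psi> where \<psi>: "\<psi> \<in> hom Ksp (K0 C)" "\<And>Y. Y \<in> X \<Longrightarrow> \<psi> (csp Y) = cl C Y"
    "\<And>A. A \<in> Ob C \<Longrightarrow> \<psi> (ind A) = cl C A"
  proof (rule hom_from_Ksp[OF tri.object_relations_axioms])
    show "(A, B, D) \<in> triangle_objects C" if "conflation A B D" for A B D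
      using that unfolding conflation_iff distinguished_def triangle_objects_def by blast
  qed (simp add: K0_def cl_def)
  have grp: "group (K0 C)" using tri.comm_group_K0 by (simp add: K0_def comm_group.axioms(2))
  obtain \<Psi> where \<Psi>: "\<Psi> \<in> hom Kang (K0 C)"
    "\<And>x. x \<in> carrier Ksp \<Longrightarrow> \<Psi> (proj_ang C n X x) = \<psi> x"
    unfolding K0_ang_eq proj_ang_eq
    by (rule ang.quotient_universal[OF grp \<psi>(1)]) (use angle_sum_vanishes[OF _ \<psi>(1,2)] in blast)+
  have "\<Psi> (\<Phi> x) = x" if "x \<in> carrier (K0 C)" for x
    using tri.K0_hom_eqI[of "K0 C" "\<Psi> \<circ> \<Phi>" id x] grp Group.hom_compose[OF \<Phi>(1) \<Psi>(1)] \<Phi>(2) \<Psi>(2) \<psi>(3)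
      ind_closed that
    by (simp add: K0_def cl_def hom_def ang_class_def)
  moreover have "\<Phi> (\<Psi> y) = y" if y: "y \<in> carrier Kang" for y
  proof -
    obtain x where x: "x \<in> carrier Ksp" "y = proj_ang C n X x"
      using ang.quot_surj y unfolding K0_ang_eq proj_ang_eq by blast
    have "(\<Phi> \<circ> \<psi>) x = proj_ang C n X x"
      using sp.K0_hom_eqI[of Kang "\<Phi> \<circ> \<psi>" "proj_ang C n X" x] Kang.is_group
        Group.hom_compose[OF \<psi>(1) \<Phi>(1)] proj.homh \<psi>(2) \<Phi>(2) x(1) X_object ind_X
      by (simp add: K0_sp_def cl_sp_def ang_class_def)
    then show ?thesis using x \<Psi>(2) by simp
  qed
  ultimately have "\<Phi> \<in> iso (K0 C) Kang" using inverse_homs_imp_iso[OF \<Phi>(1) \<Psi>(1)] by blast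
  with \<Phi>(2) show ?thesis by blast
qed

end

theorem theorem5p22:
  fixes C :: "('o, 'm) tricat" and X :: "'o set" and n :: nat
  assumes "triangulated_category C"
    and "idempotent_complete C"
    and "n \<ge> 2"
    and "cluster_tilting C n X"
    and "shifted_subcat C n X = X"
  shows "is_index_isomorphism C n X (index C n X) \<and>
    (\<exists>\<Phi> \<in> iso (K0 C) (K0_ang C n X).
       \<forall>A \<in> Ob C. \<Phi> (cl C A) = proj_ang C n X (index C n X (cl_R C X A)))"
proof -
  interpret cluster_tilting_subcategory C n X
    using assms by (simp add: cluster_tilting_subcategory_def cluster_tilting_subcategory_axioms_def)
  show ?thesis
    using index_eq(1) K0_iso_K0_ang by (simp add: index_eq(2) ang_class_def cong: ball_cong)
qed

end
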